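(* Consider the binary delegation problem described in the context. Let $\mu^*(\mu_p)=\frac{\sqrt{\mu_p}}{\sqrt{\mu_p}+\sqrt{1-\mu_p}}$ be the principal's optimal choice of the agent's prior when her own prior is $\mu_p$. Then, as functions of $\mu_p\in(1/2,1)$, both the optimal misalignment $|\mu_p-\mu^*(\mu_p)|$ and the benefit of misalignment $V(\mu_p;\mu^*(\mu_p))-V(\mu_p;\mu_p)$ are single-peaked, where $$V(\mu_p;\mu)=\mu_p\,\pi^*_\mu(R|r)+(1-\mu_p)\,\pi^*_\mu(L|l).$$
   Context: Single-peaked on an interval means: there is a point such that the function is (weakly) increasing to the left of it and (weakly) decreasing to the right of it. Binary delegation problem. States $\Omega=\{l,r\}$, actions $\mathcal A=\{L,R\}$, payoff $u(L,l)=u(R,r)=1$, $u(L,r)=u(R,l)=0$. A belief is represented by the probability $\mu\in[0,1]$ it assigns to $r$. Agent's problem. An agent with prior $\mu$ chooses a signal structure $\phi:\Omega\to\Delta(\mathcal S)$ (with $\mathcal S$ a fixed, sufficiently rich signal space) and a choice rule $\sigma:\mathcal S\to\Delta(\mathcal A)$ to maximize $$\sum_{\omega}\mu(\omega)\sum_{s,a}\phi(s|\omega)\sigma(a|s)u(a,\omega)-c(\phi,\mu),$$ where $\mu(r)=\mu$, $\mu(l)=1-\mu$. The information cost is uniformly posterior separable: $c(\phi,\mu)=\lambda\big(\mathbb E[\hat c(\eta(s))\mid\phi]-\hat c(\mu)\big)$, $\lambda>0$, where $\eta(s)\in[0,1]$ is the posterior probability of $r$ after signal $s$ (Bayes' rule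 from $\mu$ and $\phi$) and the expectation is over $s$ under the agent's prior. Here $\hat c:[0,1]\to\mathbb R\cup\{+\infty\}$ is finite, strictly convex and twice continuously differentiable on $(0,1)$, symmetric ($\hat c(x)=\hat c(1-x)$), satisfies the Inada condition $\lim_{x\to0+}\hat c'(x)=-\infty$, and $\hat c(0)=\hat c(1)=\lim_{x\to 0+}\hat c(x)$. $\pi^*_\mu(a|\omega)=\sum_s\phi^*_\mu(s|\omega)\sigma^*_\mu(a|s)$ denotes the probability that action $a$ is taken in state $\omega$ under the optimal strategy $(\phi^*_\mu,\sigma^*_\mu)$ of the agent with prior $\mu$. $V(\mu_p;\mu)$ is the expected payoff of a principal with prior $\mu_p$ (who bears no information cost) from delegating to agent $\mu$; "aligned delegation" is $\mu=\mu_p$. *)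

theory Defs
  imports "HOL-Probability.Probability"
begin

datatype state = State_l | State_r
datatype action = Act_L | Act_R

fun payoff :: "action \<Rightarrow> state \<Rightarrow> real" where
  "payoff Act_L State_l = 1"
| "payoff Act_R State_r = 1"
| "payoff Act_L State_r = 0"
| "payoff Act_R State_l = 0"

text \<open>A belief is the probability it assigns to \<^const>\<open>State_r\<close>.\<close>

definition state_dist :: "real \<Rightarrow> state pmf" where
  "state_dist \<mu> = map_pmf (\<lambda>b. if b then State_r else State_l) (bernoulli_pmf \<mu>)"

definition strictly_convex_on :: "real set \<Rightarrow> (real \<Rightarrow> real) \<Rightarrow> bool" where
  "strictly_convex_on I f \<longleftrightarrow>
     (\<forall>x\<in>I. \<forall>y\<in>I. \<forall>t\<in>{0<..<1}. x \<noteq> y \<longrightarrow>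
        f ((1 - t) * x + t * y) < (1 - t) * f x + t * f y)"

text \<open>
  The potential has values in the reals extended by plus infinity, the infinite value being
  possible only at the endpoints 0 and 1.  Its values outside the unit interval are irrelevant.
\<close>

definition cost_potential :: "(real \<Rightarrow> ereal) \<Rightarrow> bool" where
  "cost_potential chat \<longleftrightarrow>
     (let f = (\<lambda>x. real_of_ereal (chat x)) in
       (\<forall>x\<in>{0<..<1}. \<bar>chat x\<bar> \<noteq> \<infinity>) \<and>
       strictly_convex_on {0<..<1} f \<and>
       f differentiable_on {0<..<1} \<and>
       deriv f differentiable_on {0<..<1} \<and>
       continuous_on {0<..<1} (deriv (deriv f)) \<and>
       (\<forall>x\<in>{0..1}. chat x = chat (1 - x)) \<and>
       filterlim (deriv f) at_bot (at_right 0) \<and>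
       chat 0 = chat 1 \<and>
       (chat \<longlongrightarrow> chat 0) (at_right 0))"

text \<open>
  Expectation of an extended real function, as positive part minus negative part.  A
  \<^const>\<open>cost_potential\<close> is bounded below on the unit interval, so the negative part is finite
  wherever this is used.
\<close>

definition ereal_expectation :: "'s pmf \<Rightarrow> ('s \<Rightarrow> ereal) \<Rightarrow> ereal" where
  "ereal_expectation p f =
     enn2ereal (\<integral>\<^sup>+ s. e2ennreal (f s) \<partial>measure_pmf p) -
     enn2ereal (\<integral>\<^sup>+ s. e2ennreal (- f s) \<partial>measure_pmf p)"

definition signal_dist :: "real \<Rightarrow> (state \<Rightarrow> 's pmf) \<Rightarrow> 's pmf" where
  "signal_dist \<mu> \<phi> = bind_pmf (state_dist \<mu>) \<phi>"

text \<open>Bayes' rule; on signals of probability 0 the value is irrelevant.\<close>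

definition posterior :: "real \<Rightarrow> (state \<Rightarrow> 's pmf) \<Rightarrow> 's \<Rightarrow> real" where
  "posterior \<mu> \<phi> s = \<mu> * pmf (\<phi> State_r) s / pmf (signal_dist \<mu> \<phi>) s"

definition info_cost :: "(real \<Rightarrow> ereal) \<Rightarrow> real \<Rightarrow> (state \<Rightarrow> 's pmf) \<Rightarrow> real \<Rightarrow> ereal" where
  "info_cost chat lam \<phi> \<mu> =
     ereal lam * (ereal_expectation (signal_dist \<mu> \<phi>) (\<lambda>s. chat (posterior \<mu> \<phi> s)) - chat \<mu>)"

definition agent_objective ::
  "(real \<Rightarrow> ereal) \<Rightarrow> real \<Rightarrow> real \<Rightarrow> (state \<Rightarrow> 's pmf) \<Rightarrow> ('s \<Rightarrow> action pmf) \<Rightarrow> ereal" where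
  "agent_objective chat lam \<mu> \<phi> \<sigma> =
     ereal (\<Sum>\<omega>\<in>{State_l, State_r}. pmf (state_dist \<mu>) \<omega> *
              measure_pmf.expectation (\<phi> \<omega>)
                (\<lambda>s. \<Sum>a\<in>{Act_L, Act_R}. pmf (\<sigma> s) a * payoff a \<omega>))
     - info_cost chat lam \<phi> \<mu>"

definition optimal_strategy ::
  "(real \<Rightarrow> ereal) \<Rightarrow> real \<Rightarrow> real \<Rightarrow> (state \<Rightarrow> 's pmf) \<Rightarrow> ('s \<Rightarrow> action pmf) \<Rightarrow> bool" where
  "optimal_strategy chat lam \<mu> \<phi> \<sigma> \<longleftrightarrow>
     (\<forall>(\<phi>' :: state \<Rightarrow> 's pmf) (\<sigma>' :: 's \<Rightarrow> action pmf).
        agent_objective chat lam \<mu> \<phi>' \<sigma>' \<le> agent_objective chat lam \<mu> \<phi> \<sigma>)"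

definition choice_prob ::
  "(state \<Rightarrow> 's pmf) \<Rightarrow> ('s \<Rightarrow> action pmf) \<Rightarrow> action \<Rightarrow> state \<Rightarrow> real" where
  "choice_prob \<phi> \<sigma> a \<omega> = pmf (bind_pmf (\<phi> \<omega>) \<sigma>) a"

text \<open>
  The families \<open>\<phi>\<close> and \<open>\<sigma>\<close> give, for each prior, the strategy used by the agent with that prior.
\<close>

definition principal_value ::
  "(real \<Rightarrow> state \<Rightarrow> 's pmf) \<Rightarrow> (real \<Rightarrow> 's \<Rightarrow> action pmf) \<Rightarrow> real \<Rightarrow> real \<Rightarrow> real" where
  "principal_value \<phi> \<sigma> \<mu>p \<mu> =
     \<mu>p * choice_prob (\<phi> \<mu>) (\<sigma> \<mu>) Act_R State_r
     + (1 - \<mu>p) * choice_prob (\<phi> \<mu>) (\<sigma> \<mu>) Act_L State_l"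

definition best_prior :: "real \<Rightarrow> real" where
  "best_prior \<mu>p = sqrt \<mu>p / (sqrt \<mu>p + sqrt (1 - \<mu>p))"

definition single_peaked_on :: "real set \<Rightarrow> (real \<Rightarrow> real) \<Rightarrow> bool" where
  "single_peaked_on I f \<longleftrightarrow>
     (\<exists>m\<in>I. mono_on {x\<in>I. x \<le> m} f \<and> antimono_on {x\<in>I. m \<le> x} f)"

end

theory Submission
  imports Defs
begin

text \<open>
  By the Inada condition and symmetry there is \<open>q > 1/2\<close> with \<open>lam * f' q = 1\<close>; the horizontal line
  through \<open>q\<close> and \<open>1 - q\<close> supports the agent's net payoff, so an agent with prior in
  \<open>[1 - q, q]\<close> generates exactly the posteriors \<open>q\<close> (then plays R) and \<open>1 - q\<close> (then plays L), while
  outside this interval the tangent at the prior is a supporting line touched only there, and the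
  agent plays one action for sure.  In every case an optimal strategy attains the affine bound, so
  almost surely each signal and action must be a point of contact.

  With \<open>k = q / (2 * q - 1)\<close> the principal's value inside the interval is
  \<open>k * (1 - (1 - q) * (p / m + (1 - p) / (1 - m)))\<close>, maximal at \<^const>\<open>best_prior\<close>.  In terms of
  \<open>s = sqrt p\<close> and \<open>t = sqrt (1 - p)\<close> the benefit of misalignment is decreasing in \<open>s * t\<close>
  for \<open>p \<le> q\<close>, equals \<open>(q * t - (1 - q) * s)\<^sup>2 / (2 * q - 1)\<close> from \<open>q\<close> until the best prior
  reaches \<open>q\<close>, and vanishes afterwards; it peaks at \<open>q\<close>.  The squared misalignment is
  \<open>w\<^sup>2 * (1 - w) / (4 * (1 + w))\<close> for \<open>w = 2 * s * t\<close>, which peaks at \<open>w = (sqrt 5 - 1) / 2\<close>.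
\<close>

subsection \<open>The cost potential\<close>

locale info_cost_potential =
  fixes chat :: "real \<Rightarrow> ereal"
  assumes cost_potential: "cost_potential chat"
begin

text \<open>\<open>real_of_ereal\<close> sends an infinite endpoint value to 0, so \<open>f\<close>
  carries information only where \<open>chat\<close> is finite. This is why later bounds are guarded
  by \<open>chat x \<noteq> \<infinity>\<close>.\<close>

definition f :: "real \<Rightarrow> real" where "f x = real_of_ereal (chat x)"

abbreviation f' :: "real \<Rightarrow> real" where "f' \<equiv> deriv f"

lemma f_eq: "f = (\<lambda>x. real_of_ereal (chat x))"
  by (simp add: f_def fun_eq_iff)

lemma
  shows chat_finite: "\<And>x. x \<in> {0<..<1} \<Longrightarrow> \<bar>chat x\<bar> \<noteq> \<infinity>"
    and strictly_convex: "strictly_convex_on {0<..<1} f"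
    and f_differentiable_on: "f differentiable_on {0<..<1}"
    and f'_differentiable_on: "f' differentiable_on {0<..<1}"
    and chat_sym: "\<And>x. x \<in> {0..1} \<Longrightarrow> chat x = chat (1 - x)"
    and f'_at_bot: "filterlim f' at_bot (at_right 0)"
    and chat_1: "chat 1 = chat 0"
    and chat_tendsto: "(chat \<longlongrightarrow> chat 0) (at_right 0)"
  using cost_potential[unfolded cost_potential_def Let_def, folded f_eq] by - (elim conjE; (assumption | erule (1) bspec | erule sym))+

lemma chat_eq: "0 < x \<Longrightarrow> x < 1 \<Longrightarrow> chat x = ereal (f x)"
  using chat_finite[of x] by (simp add: f_def ereal_real)

lemma f_sym: "x \<in> {0..1} \<Longrightarrow> f (1 - x) = f x"
  using chat_sym[of x] by (simp add: f_def)

lemma DERIV_f: "0 < x \<Longrightarrow> x < 1 \<Longrightarrow> (f has_real_derivative f' x) (at x)"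
  using f_differentiable_on
  by (simp add: differentiable_on_eq_differentiable_at DERIV_deriv_iff_real_differentiable)

lemma continuous_on_f': "continuous_on {0<..<1} f'"
  by (rule differentiable_imp_continuous_on[OF f'_differentiable_on])

text \<open>Differentiate the identity \<open>f (1 - y) = f y\<close>, valid in a neighbourhood of
  \<open>x\<close>. Later it carries facts about one half of the interval to the other.\<close>

lemma f'_sym:
  assumes "0 < x" "x < 1"
  shows "f' (1 - x) = - f' x"
proof -
  have "(f has_real_derivative f' (1 - x)) (at (1 - x))"
    by (rule DERIV_f) (use assms in auto)
  moreover have "((\<lambda>y. 1 - y) has_real_derivative 0 - 1) (at x)"
    by (rule derivative_intros)+
  ultimately have "((\<lambda>y. f (1 - y)) has_real_derivative f' (1 - x) * (0 - 1)) (at x)"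
    by (rule DERIV_chain2)
  moreover have "\<forall>\<^sub>F y in nhds x. f (1 - y) = f y"
    by (rule eventually_mono[OF eventually_nhds_in_open[of "{0<..<1}"]])
       (use assms f_sym in auto)
  ultimately have "(f has_real_derivative f' (1 - x) * (0 - 1)) (at x)"
    by (subst (asm) DERIV_cong_ev[OF refl _ refl]) auto
  from DERIV_unique[OF this DERIV_f[OF assms]] show ?thesis by simp
qed

lemma convex_on_f: "convex_on {0<..<1} f"
proof (rule convex_onI)
  fix t x y :: real assume t: "0 < t" "t < 1" and xy: "x \<in> {0<..<1}" "y \<in> {0<..<1}"
  show "f ((1 - t) *\<^sub>R x + t *\<^sub>R y) \<le> (1 - t) * f x + t * f y"
  proof (cases "x = y")
    case True
    then show ?thesis by (simp add: algebra_simps)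
  next
    case False
    then show ?thesis
      using strictly_convex[unfolded strictly_convex_on_def, rule_format, of x y t] t xy by simp
  qed
qed simp

section \<open>Strict tangent inequalities, up to the endpoints\<close>

lemma tangent_le_f:
  assumes "0 < x" "x < 1" "0 < y" "y < 1"
  shows "f x + f' x * (y - x) \<le> f y"
  using convex_on_imp_above_tangent[OF convex_on_f, of x y "f' x"] assms
    DERIV_subset[OF DERIV_f[of x], of "{0<..<1}"] by (simp add: interior_open)

text \<open>Strict convexity at the midpoint of \<open>x\<close> and \<open>y\<close>, combined with
  the weak tangent inequality there, leaves strict room at \<open>y\<close>.\<close>

lemma tangent_less_f:
  assumes "0 < x" "x < 1" "0 < y" "y < 1" "x \<noteq> y"
  shows "f x + f' x * (y - x) < f y"
proof -
  have "f ((x + y) / 2) < (f x + f y) / 2"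
    using strictly_convex[unfolded strictly_convex_on_def, rule_format, of x y "1/2"] assms
    by (simp add: field_simps)
  moreover have "f x + f' x * ((x + y) / 2 - x) \<le> f ((x + y) / 2)"
    by (rule tangent_le_f) (use assms in auto)
  ultimately show ?thesis by (simp add: field_simps)
qed

text \<open>The gap between \<open>f\<close> and its tangent grows away from the point of tangency, so
  strictness survives the limit at the endpoint.\<close>

lemma tangent_less_chat_0:
  assumes "0 < x" "x < 1"
  shows "ereal (f x + f' x * (0 - x)) < chat 0"
proof -
  define d where "d = f (x/2) - (f x + f' x * (x/2 - x))"
  have d: "d > 0"
    unfolding d_def using tangent_less_f[of x "x/2"] assms by simp
  have gap: "f x + f' x * (y - x) + d \<le> f y" if y: "0 < y" "y < x/2" for y
  proof -
    \<comment> \<open>The weight that writes \<open>x/2\<close> as the convex combination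
      \<open>(1 - t) * y + t * x\<close>. Strict convexity at that point then bounds the gap at
      \<open>y\<close> below by the gap at \<open>x/2\<close>.\<close>
    define t where "t = (x/2 - y) / (x - y)"
    have t: "0 < t" "t < 1" using y by (auto simp: t_def field_simps)
    have e: "(1 - t) * y + t * x = x/2" 
    proof -
      have "t * (x - y) = x/2 - y" using y by (simp add: t_def)
      then show ?thesis by (simp add: algebra_simps)
    qed
    have "f (x/2) < (1 - t) * f y + t * f x"
      using strictly_convex[unfolded strictly_convex_on_def, rule_format, of y x t] t y assms e
      by auto
    then have "d < (1 - t) * f y + t * f x - (f x + f' x * ((1 - t) * y + t * x - x))"
      unfolding e d_def by simp
    also have "\<dots> = (1 - t) * (f y - (f x + f' x * (y - x)))"
      by (simp add: algebra_simps)
    also have "\<dots> \<le> 1 * (f y - (f x + f' x * (y - x)))"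
      by (rule mult_right_mono) (use t tangent_le_f[of x y] y assms in auto)
    finally show ?thesis by simp
  qed
  have "ereal (f x + f' x * (0 - x) + d) \<le> chat 0"
  proof (rule tendsto_le[OF _ chat_tendsto])
    show "((\<lambda>y. ereal (f x + f' x * (y - x) + d)) \<longlongrightarrow> ereal (f x + f' x * (0 - x) + d)) (at_right 0)"
      by (intro tendsto_intros)
    show "\<forall>\<^sub>F y in at_right 0. ereal (f x + f' x * (y - x) + d) \<le> chat y"
      using eventually_at_right_less[of 0] eventually_at_right_real[of 0 "x/2"] assms
      by (auto elim!: eventually_mono simp: chat_eq gap)
  qed simp
  moreover have "ereal (f x + f' x * (0 - x)) < ereal (f x + f' x * (0 - x) + d)"
    using d by simp
  ultimately show ?thesis by (rule less_le_trans[rotated])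
qed

lemma tangent_less_chat:
  assumes x: "0 < x" "x < 1" and y: "0 \<le> y" "y \<le> 1" "y \<noteq> x"
  shows "ereal (f x + f' x * (y - x)) < chat y"
proof -
  consider "y = 0" | "y = 1" | "0 < y" "y < 1" using y by linarith
  then show ?thesis
  proof cases
    case 1
    then show ?thesis using tangent_less_chat_0[OF x] by simp
  next
    case 2
    show ?thesis
      using tangent_less_chat_0[of "1 - x"] x 2 by (simp add: chat_1 f_sym f'_sym algebra_simps)
  next
    case 3
    then show ?thesis using tangent_less_f[of x y] x y by (simp add: chat_eq)
  qed
qed

lemma f'_half: "f' (1/2) = 0"
  using f'_sym[of "1/2"] by simp

text \<open>The tangent at \<open>1/2\<close> is horizontal by symmetry. The resulting lower bound
  keeps the negative part of every expected cost finite.\<close>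

lemma chat_ge:
  assumes "x \<in> {0..1}"
  shows "ereal (f (1/2)) \<le> chat x"
proof (cases "x = 1/2")
  case True
  show ?thesis unfolding True by (simp add: chat_eq)
next
  case False
  then show ?thesis using tangent_less_chat[of "1/2" x] assms by (simp add: f'_half less_imp_le)
qed

lemma chat_eq_if_finite:
  assumes "x \<in> {0..1}" "chat x \<noteq> \<infinity>"
  shows "chat x = ereal (f x)"
  using chat_ge[OF assms(1)] assms(2) unfolding f_def by (cases "chat x") auto

lemma tangent_less:
  assumes "0 < x" "x < 1" "y \<in> {0..1}" "chat y \<noteq> \<infinity>" "y \<noteq> x"
  shows "f x + f' x * (y - x) < f y"
  using tangent_less_chat[of x y] chat_eq_if_finite[of y] assms by auto

text \<open>The Inada condition gives a point near 0 with derivative at most \<open>- k\<close>. The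
  intermediate value theorem up to \<open>1/2\<close>, where the derivative vanishes, finds the
  value \<open>- k\<close>, and reflection turns it into \<open>k\<close>.\<close>

lemma f'_attains:
  assumes "k > 0"
  obtains q where "1/2 < q" "q < 1" "f' q = k"
proof -
  have "\<forall>\<^sub>F x in at_right 0. f' x \<le> - k"
    using f'_at_bot by (simp add: filterlim_at_bot)
  then have "\<forall>\<^sub>F x in at_right 0. f' x \<le> - k \<and> x \<in> {0<..<1/2}"
    using eventually_at_right_real[of 0 "1/2"] by (auto elim: eventually_elim2)
  from eventually_happens[OF this] obtain x where x: "f' x \<le> - k" "0 < x" "x < 1/2"
    by auto
  have "\<exists>z\<ge>x. z \<le> 1/2 \<and> f' z = - k"
    by (rule IVT') (use x assms f'_half in
        \<open>auto intro: continuous_on_subset[OF continuous_on_f']\<close>)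
  then obtain z where z: "x \<le> z" "z \<le> 1/2" "f' z = - k" by blast
  then have "z \<noteq> 1/2" using f'_half assms by (metis neg_equal_0_iff_equal less_irrefl)
  with z x have "1/2 < 1 - z" "1 - z < 1" "f' (1 - z) = k" by (auto simp: f'_sym)
  then show thesis by (rule that)
qed

text \<open>Add the strict tangent inequalities at \<open>x\<close> and at \<open>y\<close>.\<close>

lemma f'_strict_mono:
  assumes "0 < x" "x < y" "y < 1"
  shows "f' x < f' y"
proof -
  have "f' x * (y - x) < f' y * (y - x)"
    using tangent_less_f[of x y] tangent_less_f[of y x] assms by (simp add: algebra_simps)
  then show ?thesis using assms by simp
qed

end

subsection \<open>Signals and posteriors\<close>

lemma pmf_state_dist:
  assumes "\<mu> \<in> {0..1}"
  shows "pmf (state_dist \<mu>) State_r = \<mu>" "pmf (state_dist \<mu>) State_l = 1 - \<mu>"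
proof -
  have "state_dist \<mu> = bind_pmf (bernoulli_pmf \<mu>) (\<lambda>b. return_pmf (if b then State_r else State_l))"
    by (simp add: state_dist_def map_pmf_def)
  then show "pmf (state_dist \<mu>) State_r = \<mu>" "pmf (state_dist \<mu>) State_l = 1 - \<mu>"
    using assms by (simp_all add: pmf_bind)
qed

lemma pmf_signal_dist:
  assumes "\<mu> \<in> {0..1}"
  shows "pmf (signal_dist \<mu> \<phi>) s = \<mu> * pmf (\<phi> State_r) s + (1 - \<mu>) * pmf (\<phi> State_l) s"
  using assms
  by (simp add: signal_dist_def state_dist_def bind_map_pmf pmf_bind mult.commute)

text \<open>Bayes' rule without division. It also covers null signals: there both nonnegative
  summands of the signal probability vanish.\<close>

lemma pmf_signal_dist_posterior:
  assumes "\<mu> \<in> {0..1}"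
  shows "pmf (signal_dist \<mu> \<phi>) s * posterior \<mu> \<phi> s = \<mu> * pmf (\<phi> State_r) s"
    and "pmf (signal_dist \<mu> \<phi>) s * (1 - posterior \<mu> \<phi> s) = (1 - \<mu>) * pmf (\<phi> State_l) s"
proof -
  let ?p = "signal_dist \<mu> \<phi>"
  have nn: "0 \<le> \<mu> * pmf (\<phi> State_r) s" "0 \<le> (1 - \<mu>) * pmf (\<phi> State_l) s"
    using assms by auto
  show r: "pmf ?p s * posterior \<mu> \<phi> s = \<mu> * pmf (\<phi> State_r) s"
  proof (cases "pmf ?p s = 0")
    case True
    then have "\<mu> * pmf (\<phi> State_r) s = 0"
      using nn unfolding pmf_signal_dist[OF assms] by linarith
    with True show ?thesis by simp
  qed (simp add: posterior_def)
  then show "pmf ?p s * (1 - posterior \<mu> \<phi> s) = (1 - \<mu>) * pmf (\<phi> State_l) s"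
    by (simp add: right_diff_distrib pmf_signal_dist[OF assms])
qed

lemma posterior_in:
  assumes "\<mu> \<in> {0..1}"
  shows "posterior \<mu> \<phi> s \<in> {0..1}"
proof -
  have "0 \<le> \<mu> * pmf (\<phi> State_r) s" "0 \<le> (1 - \<mu>) * pmf (\<phi> State_l) s"
    using assms by auto
  then show ?thesis
    unfolding posterior_def pmf_signal_dist[OF assms] by (auto simp: divide_le_eq_1)
qed

text \<open>A change of measure: both expectations become integrals over the counting measure, whose
  integrands agree pointwise.\<close>

lemma expectation_reweight:
  fixes h :: "'s \<Rightarrow> real"
  assumes "\<And>s. pmf p s * w s = c * pmf p' s"
  shows "measure_pmf.expectation p (\<lambda>s. w s * h s) = c * measure_pmf.expectation p' h"
proof -
  have density: "measure_pmf.expectation r k = (\<integral>s. pmf r s * k s \<partial>count_space UNIV)"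
    for r :: "'s pmf" and k :: "'s \<Rightarrow> real"
    by (subst measure_pmf_eq_density, subst integral_density) auto
  show ?thesis
    unfolding density mult.assoc[symmetric] assms by (simp add: mult.assoc)
qed

text \<open>With \<open>h = 1\<close> this says that posteriors average to the prior.\<close>

lemma expectation_posterior:
  fixes h :: "'s \<Rightarrow> real"
  assumes "\<mu> \<in> {0..1}"
  shows "measure_pmf.expectation (signal_dist \<mu> \<phi>) (\<lambda>s. posterior \<mu> \<phi> s * h s) =
           \<mu> * measure_pmf.expectation (\<phi> State_r) h"
    and "measure_pmf.expectation (signal_dist \<mu> \<phi>) (\<lambda>s. (1 - posterior \<mu> \<phi> s) * h s) =
           (1 - \<mu>) * measure_pmf.expectation (\<phi> State_l) h"
  by (rule expectation_reweight, rule pmf_signal_dist_posterior[OF assms])+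

lemma choice_prob_posterior:
  assumes "\<mu> \<in> {0..1}"
  shows "measure_pmf.expectation (signal_dist \<mu> \<phi>) (\<lambda>s. posterior \<mu> \<phi> s * pmf (\<sigma> s) a) =
           \<mu> * choice_prob \<phi> \<sigma> a State_r"
    and "measure_pmf.expectation (signal_dist \<mu> \<phi>) (\<lambda>s. (1 - posterior \<mu> \<phi> s) * pmf (\<sigma> s) a) =
           (1 - \<mu>) * choice_prob \<phi> \<sigma> a State_l"
  unfolding choice_prob_def pmf_bind by (rule expectation_posterior[OF assms])+

section \<open>Expectations of extended real functions under discrete distributions\<close>

lemma integrable_pmf_bounded:
  fixes h :: "'s \<Rightarrow> real"
  assumes "\<And>s. \<bar>h s\<bar> \<le> B"
  shows "integrable (measure_pmf p) h"
  by (rule measure_pmf.integrable_const_bound[where B = B]) (auto simp: assms)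

lemma ereal_expectation_integrable:
  assumes h: "integrable (measure_pmf p) h" and g: "\<And>s. s \<in> set_pmf p \<Longrightarrow> g s = ereal (h s)"
  shows "ereal_expectation p g = ereal (measure_pmf.expectation p h)"
proof -
  have pos: "(\<integral>\<^sup>+ s. e2ennreal (g s) \<partial>measure_pmf p) = (\<integral>\<^sup>+ s. ennreal (h s) \<partial>measure_pmf p)"
    and neg: "(\<integral>\<^sup>+ s. e2ennreal (- g s) \<partial>measure_pmf p) = (\<integral>\<^sup>+ s. ennreal (- h s) \<partial>measure_pmf p)"
    by (intro nn_integral_cong_AE; simp add: AE_measure_pmf_iff g)+
  have "(\<integral>\<^sup>+ s. ennreal (h s) \<partial>measure_pmf p) \<noteq> \<infinity>" "(\<integral>\<^sup>+ s. ennreal (- h s) \<partial>measure_pmf p) \<noteq> \<infinity>"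
    using h by (simp_all add: real_integrable_def)
  then show ?thesis
    unfolding ereal_expectation_def pos neg real_lebesgue_integral_def[OF h]
    by (cases "\<integral>\<^sup>+ s. ennreal (h s) \<partial>measure_pmf p"; cases "\<integral>\<^sup>+ s. ennreal (- h s) \<partial>measure_pmf p") auto
qed

text \<open>The lower bound makes the negative part finite, so a finite expectation forces a finite
  positive part. Almost everywhere finiteness under a \<open>pmf\<close> means finiteness at every
  support point.\<close>

lemma ereal_expectation_finiteD:
  assumes lower: "\<And>s. ereal c \<le> g s" and finite: "ereal_expectation p g \<noteq> \<infinity>"
  shows "s \<in> set_pmf p \<Longrightarrow> g s \<noteq> \<infinity>"
    and "integrable (measure_pmf p) (\<lambda>s. real_of_ereal (g s))"
proof -
  have "- g s \<le> ereal (- c)" for s using lower[of s] ereal_minus_le_minus[of "g s" "ereal c"] by simp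
  then have "e2ennreal (- g s) \<le> ennreal (- c)" for s
    using e2ennreal_mono[of "- g s" "ereal (- c)"] by simp
  then have "(\<integral>\<^sup>+ s. e2ennreal (- g s) \<partial>measure_pmf p) \<le> (\<integral>\<^sup>+ s. ennreal (- c) \<partial>measure_pmf p)"
    by (intro nn_integral_mono)
  also have "\<dots> < \<infinity>" by (simp add: less_top)
  finally have neg: "(\<integral>\<^sup>+ s. e2ennreal (- g s) \<partial>measure_pmf p) < \<infinity>" .
  with finite have pos: "(\<integral>\<^sup>+ s. e2ennreal (g s) \<partial>measure_pmf p) \<noteq> \<infinity>"
    unfolding ereal_expectation_def
    by (cases "\<integral>\<^sup>+ s. e2ennreal (- g s) \<partial>measure_pmf p") auto
  have "AE s in measure_pmf p. e2ennreal (g s) \<noteq> \<infinity>"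
    by (rule nn_integral_PInf_AE) (use pos in auto)
  then show fin: "g s \<noteq> \<infinity>" if "s \<in> set_pmf p" for s
    using that by (auto simp: AE_measure_pmf_iff)
  have g: "g s = ereal (real_of_ereal (g s))" if "s \<in> set_pmf p" for s
    using fin[OF that] lower[of s] by (cases "g s") auto
  have "(\<integral>\<^sup>+ s. e2ennreal (g s) \<partial>measure_pmf p) = (\<integral>\<^sup>+ s. ennreal (real_of_ereal (g s)) \<partial>measure_pmf p)"
    "(\<integral>\<^sup>+ s. e2ennreal (- g s) \<partial>measure_pmf p) = (\<integral>\<^sup>+ s. ennreal (- real_of_ereal (g s)) \<partial>measure_pmf p)"
    by (intro nn_integral_cong_AE; simp add: AE_measure_pmf_iff; metis g e2ennreal_ereal uminus_ereal.simps(1))+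
  with pos neg show "integrable (measure_pmf p) (\<lambda>s. real_of_ereal (g s))"
    by (simp add: real_integrable_def)
qed

lemma pmf_Act_L: "pmf p Act_L = 1 - pmf p Act_R"
proof -
  have "set_pmf p \<subseteq> {Act_L, Act_R}" by (auto intro: action.exhaust)
  then have "sum (pmf p) {Act_L, Act_R} = 1" by (rule sum_pmf_eq_1[rotated]) simp
  then show ?thesis by simp
qed

text \<open>Moves the payoff from state-conditional expectations to one expectation over signals,
  where it can be compared with the cost signal by signal.\<close>

lemma expected_payoff_posterior:
  assumes "\<mu> \<in> {0..1}"
  shows "(\<Sum>\<omega>\<in>{State_l, State_r}. pmf (state_dist \<mu>) \<omega> *
              measure_pmf.expectation (\<phi> \<omega>)
                (\<lambda>s. \<Sum>a\<in>{Act_L, Act_R}. pmf (\<sigma> s) a * payoff a \<omega>)) =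
    measure_pmf.expectation (signal_dist \<mu> \<phi>)
      (\<lambda>s. posterior \<mu> \<phi> s * pmf (\<sigma> s) Act_R + (1 - posterior \<mu> \<phi> s) * pmf (\<sigma> s) Act_L)"
proof -
  have bound: "\<bar>posterior \<mu> \<phi> s * pmf (\<sigma> s) a\<bar> \<le> 1" "\<bar>(1 - posterior \<mu> \<phi> s) * pmf (\<sigma> s) a\<bar> \<le> 1" for s a
    using posterior_in[OF assms, of \<phi> s] by (auto simp: abs_mult intro!: mult_le_one pmf_le_1)
  show ?thesis
    using assms
    by (simp add: pmf_state_dist Bochner_Integration.integral_add integrable_pmf_bounded[OF bound(1)]
        integrable_pmf_bounded[OF bound(2)] expectation_posterior)
qed

subsection \<open>The best prior and the value of delegation\<close>

lemma best_prior_in: 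
  assumes "p \<in> {0<..<1}" shows "best_prior p \<in> {0<..<1}"
  using assms unfolding best_prior_def by (auto simp: divide_simps add_pos_pos)

lemma sqrt_add_sqrt_one_minus_pos:
  assumes "p \<in> {0<..<1}" shows "0 < sqrt p + sqrt (1 - p)"
  using assms by (auto intro: add_pos_pos)

lemma best_prior_le_iff:
  assumes "p \<in> {0<..<1}"
  shows "best_prior p \<le> m \<longleftrightarrow> (1 - m) * sqrt p \<le> m * sqrt (1 - p)"
  using sqrt_add_sqrt_one_minus_pos[OF assms]
  by (simp add: best_prior_def divide_le_eq algebra_simps)

lemma le_best_prior_iff:
  assumes "p \<in> {0<..<1}"
  shows "m \<le> best_prior p \<longleftrightarrow> m * sqrt (1 - p) \<le> (1 - m) * sqrt p"
  using sqrt_add_sqrt_one_minus_pos[OF assms]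
  by (simp add: best_prior_def le_divide_eq algebra_simps)

lemma best_prior_between:
  assumes "p \<in> {1/2<..<1}"
  shows "1/2 \<le> best_prior p" "best_prior p \<le> p"
proof -
  have p: "p \<in> {0<..<1}" using assms by auto
  have le: "sqrt (1 - p) \<le> sqrt p" using assms by auto
  then show "1/2 \<le> best_prior p" using le_best_prior_iff[OF p, of "1/2"] by simp
  have "(1 - p) * sqrt p = sqrt (1 - p) * sqrt p * sqrt (1 - p)" using p by simp
  also have "\<dots> \<le> sqrt p * sqrt p * sqrt (1 - p)"
    using le p by (intro mult_right_mono) auto
  also have "\<dots> = p * sqrt (1 - p)" using p by simp
  finally show "best_prior p \<le> p" using p by (simp add: best_prior_le_iff)
qed

section \<open>Minimizing \<open>p / m + (1 - p) / (1 - m)\<close> over \<open>m\<close>\<close>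

text \<open>A two-term Cauchy-Schwarz inequality; the difference of the two sides is a square over
  \<open>m * (1 - m)\<close>.\<close>

lemma sum_divide_ge_square:
  fixes s t m :: real
  assumes "0 < m" "m < 1"
  shows "(s + t)\<^sup>2 \<le> s\<^sup>2 / m + t\<^sup>2 / (1 - m)"
proof -
  have "s\<^sup>2 / m + t\<^sup>2 / (1 - m) - (s + t)\<^sup>2 = (s * (1 - m) - t * m)\<^sup>2 / (m * (1 - m))"
    using assms by (simp add: divide_simps) (simp add: power2_eq_square algebra_simps)
  also have "\<dots> \<ge> 0" using assms by simp
  finally show ?thesis by simp
qed

lemma weighted_inverse_ge:
  assumes "p \<in> {0<..<1}" "m \<in> {0<..<1}"
  shows "1 + 2 * sqrt p * sqrt (1 - p) \<le> p / m + (1 - p) / (1 - m)"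
  using sum_divide_ge_square[of m "sqrt p" "sqrt (1 - p)"] assms
  by (simp add: power2_sum)

text \<open>The equality case of the Cauchy-Schwarz bound: \<open>best_prior p\<close> is
  \<open>s / (s + t)\<close> for \<open>s = sqrt p\<close> and \<open>t = sqrt (1 - p)\<close>, and
  \<open>(s + t)\<^sup>2 = 1 + 2 * s * t\<close>.\<close>

lemma weighted_inverse_best_prior:
  assumes "p \<in> {0<..<1}"
  shows "p / best_prior p + (1 - p) / (1 - best_prior p) = 1 + 2 * sqrt p * sqrt (1 - p)"
proof -
  define s t where st: "s = sqrt p" "t = sqrt (1 - p)"
  have pos: "s > 0" "t > 0" and sq: "p = s\<^sup>2" "1 - p = t\<^sup>2" using assms by (auto simp: st)
  have b: "best_prior p = s / (s + t)" "1 - best_prior p = t / (s + t)"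
    using pos by (simp_all add: best_prior_def st[symmetric] field_simps)
  have "p / best_prior p = s * (s + t)"
    using pos sq(1) b(1) by (simp add: power2_eq_square)
  moreover have "(1 - p) / (1 - best_prior p) = t * (s + t)"
    unfolding b(2) sq(2) using pos by (simp add: power2_eq_square)
  ultimately have "p / best_prior p + (1 - p) / (1 - best_prior p) = (s + t)\<^sup>2"
    by (simp add: power2_eq_square algebra_simps)
  also have "\<dots> = s\<^sup>2 + t\<^sup>2 + 2 * s * t" by (simp add: power2_sum)
  also have "\<dots> = 1 + 2 * s * t" using sq by simp
  finally show ?thesis by (simp add: st)
qed

text \<open>The weighted inverse falls to the left of its minimizer. The difference of its values at
  \<open>m\<close> and \<open>q\<close> has the factor \<open>q - m\<close>, and the other factor is
  nonnegative because both points lie below the best prior.\<close>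

lemma weighted_inverse_antimono:
  assumes p: "p \<in> {0<..<1}" and m: "0 < m" "m \<le> q" "q < 1" and q: "q \<le> best_prior p"
  shows "p / q + (1 - p) / (1 - q) \<le> p / m + (1 - p) / (1 - m)"
proof -
  define s t where st: "s = sqrt p" "t = sqrt (1 - p)"
  have pos: "s > 0" "t > 0" and sq: "p = s\<^sup>2" "1 - p = t\<^sup>2" using p by (auto simp: st)
  have tq: "q * t \<le> (1 - q) * s" using le_best_prior_iff[OF p] q by (simp add: st)
  have "m * t \<le> q * t" "(1 - q) * s \<le> (1 - m) * s" using m pos by auto
  with tq have tm: "m * t \<le> (1 - m) * s" by linarith
  have "(m * t) * (q * t) \<le> ((1 - m) * s) * ((1 - q) * s)"
    by (rule mult_mono) (use tm tq m pos in auto)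
  then have "0 \<le> (q - m) * ((1 - m) * (1 - q) * s\<^sup>2 - m * q * t\<^sup>2) / (m * q * (1 - m) * (1 - q))"
    using m by (intro divide_nonneg_nonneg mult_nonneg_nonneg) (auto simp: power2_eq_square algebra_simps)
  also have "\<dots> = (s\<^sup>2 / m + t\<^sup>2 / (1 - m)) - (s\<^sup>2 / q + t\<^sup>2 / (1 - q))"
    using m by (simp add: divide_simps) (simp add: algebra_simps)
  finally show ?thesis unfolding sq(2) by (simp add: sq(1)[symmetric])
qed

section \<open>The size of the misalignment\<close>

lemma sqrt_prod_antimono:
  assumes "1/2 \<le> x" "x \<le> y" "y \<le> 1"
  shows "sqrt y * sqrt (1 - y) \<le> sqrt x * sqrt (1 - x)"
proof -
  have "0 \<le> (y - x) * (x + y - 1)" using assms by simp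
  then have "y * (1 - y) \<le> x * (1 - x)" by (simp add: algebra_simps)
  then show ?thesis by (simp flip: real_sqrt_mult)
qed

text \<open>Since \<open>s\<^sup>2 + t\<^sup>2 = 1\<close>, the misalignment is
  \<open>s * t * (s - t) / (s + t)\<close>, while \<open>1 - w\<close> and \<open>1 + w\<close> are
  the squares of \<open>s - t\<close> and \<open>s + t\<close>.\<close>

lemma misalignment_eq:
  assumes "p \<in> {1/2<..<1}"
  defines "w \<equiv> 2 * sqrt p * sqrt (1 - p)"
  shows "\<bar>p - best_prior p\<bar> = sqrt (w\<^sup>2 * (1 - w) / (1 + w)) / 2"
proof -
  define s t where st: "s = sqrt p" "t = sqrt (1 - p)"
  have pos: "s > 0" "t > 0" and sq: "p = s\<^sup>2" "1 - p = t\<^sup>2" using assms by (auto simp: st)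
  have one: "s\<^sup>2 + t\<^sup>2 = 1" using sq by simp
  have w: "w = 2 * s * t" "1 - w = (s - t)\<^sup>2" "1 + w = (s + t)\<^sup>2"
    using one by (auto simp: w_def st[symmetric] power2_eq_square algebra_simps)
  have "p - best_prior p = s\<^sup>2 - s / (s + t)" using sq by (simp add: best_prior_def st)
  also have "\<dots> = s * (s * (s + t) - 1) / (s + t)"
    using pos by (simp add: field_simps power2_eq_square)
  also have "s * (s + t) - 1 = t * (s - t)"
    unfolding one[symmetric] by (simp add: power2_eq_square algebra_simps)
  finally have "\<bar>p - best_prior p\<bar> = \<bar>w * (s - t) / (s + t)\<bar> / 2"
    using w(1) by (simp add: abs_mult)
  also have "\<bar>w * (s - t) / (s + t)\<bar> = sqrt ((w * (s - t) / (s + t))\<^sup>2)" by simp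
  also have "(w * (s - t) / (s + t))\<^sup>2 = w\<^sup>2 * (1 - w) / (1 + w)"
    by (simp only: w(2,3) power_divide power_mult_distrib)
  finally show ?thesis .
qed

lemma has_real_derivative_misalignment_square:
  fixes w :: real
  assumes "0 \<le> w"
  shows "((\<lambda>w. w\<^sup>2 * (1 - w) / (1 + w)) has_real_derivative
           2 * w * (1 - w - w\<^sup>2) / (1 + w)\<^sup>2) (at w)"
  using assms
  by (auto intro!: derivative_eq_intros simp: divide_simps)
     (auto simp: power2_eq_square algebra_simps)

text \<open>The misalignment is an increasing function of \<open>g (W p)\<close>, where
  \<open>g\<close> peaks at \<open>w0\<close> and \<open>W\<close> is decreasing. Hence the branches
  swap: to the left of the peak \<open>m\<close>, \<open>W\<close> is at least \<open>w0\<close> and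
  the falling branch of \<open>g\<close> applies.\<close>

lemma single_peaked_misalignment:
  "single_peaked_on {1/2<..<1} (\<lambda>p. \<bar>p - best_prior p\<bar>)"
proof -
  define g where "g = (\<lambda>w::real. w\<^sup>2 * (1 - w) / (1 + w))"
  define W where "W = (\<lambda>p. 2 * sqrt p * sqrt (1 - p))"
  \<comment> \<open>The positive root of \<open>w\<^sup>2 + w = 1\<close>, where the derivative of
    \<open>g\<close> changes sign.\<close>
  define w0 where "w0 = (sqrt 5 - 1) / (2::real)"
  have "(2::real) < sqrt 5" "sqrt 5 < (3::real)"
    by (auto intro: real_less_rsqrt real_less_lsqrt)
  then have w0: "0 < w0" "w0 < 1" by (auto simp: w0_def)
  have w0_sq: "1 - w0 - w0\<^sup>2 = 0" by (simp add: w0_def power2_eq_square field_simps)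
  have deriv: "DERIV g w :> 2 * w * (1 - w - w\<^sup>2) / (1 + w)\<^sup>2" if "0 \<le> w" for w
    unfolding g_def by (rule has_real_derivative_misalignment_square[OF that])
  have g_mono: "g a \<le> g b" if "0 \<le> a" "a \<le> b" "b \<le> w0" for a b
  proof (rule DERIV_nonneg_imp_nondecreasing[OF that(2)])
    fix w assume w: "a \<le> w" "w \<le> b"
    have "w\<^sup>2 \<le> w0\<^sup>2" using w that by (intro power_mono) auto
    then have "0 \<le> 1 - w - w\<^sup>2" using w0_sq w that by linarith
    then show "\<exists>y. DERIV g w :> y \<and> 0 \<le> y"
      using deriv[of w] w that by (intro exI[of _ "2 * w * (1 - w - w\<^sup>2) / (1 + w)\<^sup>2"] conjI) auto
  qed
  have g_antimono: "g b \<le> g a" if "w0 \<le> a" "a \<le> b" for a b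
  proof (rule DERIV_nonpos_imp_nonincreasing[OF that(2)])
    fix w assume w: "a \<le> w" "w \<le> b"
    have "w0\<^sup>2 \<le> w\<^sup>2" using w that w0 by (intro power_mono) auto
    then have "1 - w - w\<^sup>2 \<le> 0" using w0_sq w that by linarith
    then have "2 * w * (1 - w - w\<^sup>2) / (1 + w)\<^sup>2 \<le> 0"
      using w that w0 by (intro divide_nonpos_nonneg mult_nonneg_nonpos) auto
    then show "\<exists>y. DERIV g w :> y \<and> y \<le> 0"
      using deriv[of w] w that w0 by auto
  qed
  have eq: "\<bar>p - best_prior p\<bar> = sqrt (g (W p)) / 2" if "p \<in> {1/2<..<1}" for p
    using misalignment_eq[OF that] by (simp add: g_def W_def)
  have W_anti: "W y \<le> W x" if "1/2 < x" "x \<le> y" "y < 1" for x y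
    using sqrt_prod_antimono[of x y] that by (simp add: W_def)
  have W_nonneg: "0 \<le> W x" if "1/2 < x" "x < 1" for x using that by (simp add: W_def)
  \<comment> \<open>The solution of \<open>W m = w0\<close> above \<open>1/2\<close>:
    \<open>(W m)\<^sup>2 = 1 - (2 * m - 1)\<^sup>2 = 1 - w0\<close>, which is
    \<open>w0\<^sup>2\<close>.\<close>
  define m where "m = (1 + sqrt w0) / 2"
  have m: "m \<in> {1/2<..<1}" using w0 by (auto simp: m_def)
  have "4 * (m * (1 - m)) = 1 - w0"
    using w0 by (simp add: m_def field_simps)
  also have "\<dots> = w0\<^sup>2" using w0_sq by simp
  finally have "(W m)\<^sup>2 = w0\<^sup>2" using m by (simp add: W_def power_mult_distrib)
  then have Wm: "W m = w0" using w0 W_nonneg[of m] m by (simp add: power2_eq_iff_nonneg)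
  show ?thesis
    unfolding single_peaked_on_def
  proof (intro bexI[OF _ m] conjI monotone_onI)
    fix x y assume "x \<in> {x \<in> {1/2<..<1}. x \<le> m}" "y \<in> {x \<in> {1/2<..<1}. x \<le> m}" "x \<le> y"
    then show "\<bar>x - best_prior x\<bar> \<le> \<bar>y - best_prior y\<bar>"
      using g_antimono[of "W y" "W x"] W_anti[of x y] W_anti[of y m] Wm m by (simp add: eq)
  next
    fix x y assume "x \<in> {x \<in> {1/2<..<1}. m \<le> x}" "y \<in> {x \<in> {1/2<..<1}. m \<le> x}" "x \<le> y"
    then show "\<bar>x - best_prior x\<bar> \<ge> \<bar>y - best_prior y\<bar>"
      using g_mono[of "W y" "W x"] W_anti[of x y] W_anti[of m x] W_nonneg[of y] Wm m
      by (simp add: eq)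
  qed
qed

text \<open>\<open>1 - q\<close> and \<open>q\<close> are the optimal posteriors; an agent with prior \<open>m\<close> outside the interval
  between them acquires no information.\<close>

definition delegation_value :: "real \<Rightarrow> real \<Rightarrow> real \<Rightarrow> real" where
  "delegation_value q p m =
     (if m < 1 - q then 1 - p else if q < m then p
      else q / (2 * q - 1) * (1 - (1 - q) * (p / m + (1 - p) / (1 - m))))"

section \<open>Delegation value as a function of the agent's prior\<close>

context
  fixes q :: real
  assumes q: "1/2 < q" "q < 1"
begin

text \<open>The interior formula collapses to \<open>p\<close> at \<open>m = q\<close>, so the value
  is continuous there and the boundary may be assigned to either case.\<close>

lemma delegation_value_q:
  assumes "q \<le> m" shows "delegation_value q p m = p"
proof (cases "q = m")
  case True
  have "1 - (1 - q) * (p / q + (1 - p) / (1 - q)) = p * (2 * q - 1) / q"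
    using q by (simp add: field_simps)
  then show ?thesis using True[symmetric] q by (simp add: delegation_value_def)
qed (use assms q in \<open>simp add: delegation_value_def\<close>)

lemma delegation_value_one_minus_q:
  assumes "m \<le> 1 - q" shows "delegation_value q p m = 1 - p"
proof (cases "m = 1 - q")
  case True
  have "1 - (1 - q) * (p / (1 - q) + (1 - p) / q) = (1 - p) * (2 * q - 1) / q"
    using q by (simp add: field_simps)
  then show ?thesis using True q by (simp add: delegation_value_def)
qed (use assms q in \<open>simp add: delegation_value_def\<close>)

lemma delegation_value_between:
  assumes "1 - q \<le> m" "m \<le> q"
  shows "delegation_value q p m =
    q / (2 * q - 1) * (1 - (1 - q) * (p / m + (1 - p) / (1 - m)))"
  using assms by (simp add: delegation_value_def)

lemma delegation_value_mono_weight: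
  assumes "1 - q \<le> m" "m \<le> q" "1 - q \<le> m'" "m' \<le> q"
    and "p / m' + (1 - p) / (1 - m') \<le> p / m + (1 - p) / (1 - m)"
  shows "delegation_value q p m \<le> delegation_value q p m'"
  unfolding delegation_value_between[OF assms(1,2)] delegation_value_between[OF assms(3,4)]
  using assms(5) q by (intro mult_left_mono diff_left_mono) auto

text \<open>Inside the interval the value falls as the weighted inverse grows, so the minimizer is
  best if it is at most \<open>q\<close>. Otherwise the value increases up to \<open>q\<close> and
  stays at \<open>p\<close>. Priors outside the interval do as well as the nearest endpoint.\<close>

lemma delegation_value_le_best_prior:
  assumes p: "p \<in> {1/2<..<1}" and m: "m \<in> {0<..<1}"
  shows "delegation_value q p m \<le> delegation_value q p (best_prior p)"
proof -
  have p': "p \<in> {0<..<1}" using p by auto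
  have "1 - q \<le> best_prior p" using best_prior_between(1)[OF p] q by simp
  have *: "delegation_value q p k \<le> delegation_value q p (best_prior p)"
    if k: "1 - q \<le> k" "k \<le> q" for k
  proof (cases "best_prior p \<le> q")
    case True
    show ?thesis
      by (rule delegation_value_mono_weight)
         (use weighted_inverse_ge[OF p', of k] weighted_inverse_best_prior[OF p'] k q True
            \<open>1 - q \<le> best_prior p\<close> in auto)
  next
    case False
    have "delegation_value q p k \<le> delegation_value q p q"
      by (rule delegation_value_mono_weight)
         (use weighted_inverse_antimono[OF p', of k q] k q False in auto)
    then show ?thesis using False by (simp add: delegation_value_q)
  qed
  consider "m \<le> 1 - q" | "q \<le> m" | "1 - q \<le> m" "m \<le> q" by linarith
  then show ?thesis
  proof cases
    case 1
    then show ?thesis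
      using *[of "1 - q"] q by (simp add: delegation_value_one_minus_q)
  next
    case 2
    then show ?thesis using *[of q] q by (simp add: delegation_value_q)
  qed (rule *)
qed

lemma single_peaked_delegation_benefit:
  "single_peaked_on {1/2<..<1}
     (\<lambda>p. delegation_value q p (best_prior p) - delegation_value q p p)"
proof -
  let ?B = "\<lambda>p. delegation_value q p (best_prior p) - delegation_value q p p"
  have below: "?B p = q / (2 * q - 1) * (1 - (1 - q) * (1 + 2 * sqrt p * sqrt (1 - p))) - q"
    if p: "1/2 < p" "p \<le> q" for p
  proof -
    have b: "1/2 \<le> best_prior p" "best_prior p \<le> p"
      using best_prior_between[of p] p q by auto
    \<comment> \<open>At \<open>m = p\<close> the weighted inverse is 2, so the aligned value is
      \<open>q\<close> for every such \<open>p\<close>.\<close>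
    have "delegation_value q p p = q / (2 * q - 1) * (2 * q - 1)"
      using p q by (subst delegation_value_between) (auto simp: field_simps)
    then show ?thesis
      using b p q weighted_inverse_best_prior[of p]
      by (subst delegation_value_between) auto
  qed
  \<comment> \<open>Completing the square with \<open>sqrt p ^ 2 + sqrt (1 - p) ^ 2 = 1\<close>.\<close>
  have middle: "?B p = (q * sqrt (1 - p) - (1 - q) * sqrt p)\<^sup>2 / (2 * q - 1)"
    if p: "q \<le> p" "p < 1" and b: "best_prior p \<le> q" for p
  proof -
    define s t where st: "s = sqrt p" "t = sqrt (1 - p)"
    have sq: "p = s\<^sup>2" "t\<^sup>2 = 1 - s\<^sup>2" using p q by (auto simp: st)
    have "?B p = q / (2 * q - 1) * (1 - (1 - q) * (1 + 2 * s * t)) - s\<^sup>2"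
      using b p q weighted_inverse_best_prior[of p] best_prior_between(1)[of p]
      by (simp add: delegation_value_q delegation_value_between st[symmetric] sq(1)[symmetric])
    also have "\<dots> = (q * t - (1 - q) * s)\<^sup>2 / (2 * q - 1)"
    proof -
      have "q * (1 - (1 - q) * (1 + 2 * s * t)) - s\<^sup>2 * (2 * q - 1) =
        q\<^sup>2 * (1 - s\<^sup>2) - 2 * q * (1 - q) * s * t + (1 - q)\<^sup>2 * s\<^sup>2"
        by (simp add: power2_eq_square algebra_simps)
      also have "\<dots> = (q * t - (1 - q) * s)\<^sup>2"
        unfolding sq(2)[symmetric] by (simp add: power2_eq_square algebra_simps)
      finally show ?thesis using q by (simp add: field_simps)
    qed
    finally show ?thesis by (simp add: st)
  qed
  have above: "?B p = 0" if "q \<le> best_prior p" "q \<le> p" for p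
    using that by (simp add: delegation_value_q)
  show ?thesis
    unfolding single_peaked_on_def
  proof (intro bexI[of _ q] conjI monotone_onI)
    fix x y assume "x \<in> {x \<in> {1/2<..<1}. x \<le> q}" "y \<in> {x \<in> {1/2<..<1}. x \<le> q}" "x \<le> y"
    then have xy: "1/2 < x" "x \<le> y" "y \<le> q" by auto
    have "(1 - q) * (1 + 2 * sqrt y * sqrt (1 - y)) \<le> (1 - q) * (1 + 2 * sqrt x * sqrt (1 - x))"
      using sqrt_prod_antimono[of x y] xy q by (intro mult_left_mono) auto
    then have "q / (2 * q - 1) * (1 - (1 - q) * (1 + 2 * sqrt x * sqrt (1 - x)))
      \<le> q / (2 * q - 1) * (1 - (1 - q) * (1 + 2 * sqrt y * sqrt (1 - y)))"
      using q by (intro mult_left_mono) auto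
    then show "?B x \<le> ?B y" using below[of x] below[of y] xy by simp
  next
    fix x y assume "x \<in> {x \<in> {1/2<..<1}. q \<le> x}" "y \<in> {x \<in> {1/2<..<1}. q \<le> x}" "x \<le> y"
    then have xy: "1/2 < x" "q \<le> x" "x \<le> y" "y < 1" by auto
    show "?B y \<le> ?B x"
    \<comment> \<open>In the first case the benefit at \<open>y\<close> is zero, while it is
      nonnegative at \<open>x\<close>. In the second case \<open>best_prior x \<le> q\<close>
      follows from the same bound at \<open>y\<close>, so the squared formula holds at both
      points.\<close>
    proof (cases "q \<le> best_prior y")
      case True
      then show ?thesis
        using above[of y] delegation_value_le_best_prior[of x x] xy by simp
    next
      case False
      have y: "(1 - q) * sqrt y \<le> q * sqrt (1 - y)"
        using best_prior_le_iff[of y q] False xy by simp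
      have "(1 - q) * sqrt x \<le> (1 - q) * sqrt y" "q * sqrt (1 - y) \<le> q * sqrt (1 - x)"
        using xy q by auto
      note le = y this
      then have "(1 - q) * sqrt x \<le> q * sqrt (1 - x)" by linarith
      then have x: "best_prior x \<le> q" using best_prior_le_iff[of x q] xy by simp
      \<comment> \<open>The base of the square is nonnegative at \<open>y\<close> and larger at
        \<open>x\<close>, so squaring preserves the order.\<close>
      have "(q * sqrt (1 - y) - (1 - q) * sqrt y)\<^sup>2 \<le> (q * sqrt (1 - x) - (1 - q) * sqrt x)\<^sup>2"
        using le by (intro power_mono) auto
      then show ?thesis
        using middle[of x] middle[of y] x False xy q by (simp add: divide_right_mono)
    qed
  qed (use q in auto)
qed

end

subsection \<open>The agent\<close>

locale delegation = info_cost_potential chat for chat +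
  fixes lam :: real
  assumes lam_pos: "lam > 0"
begin

text \<open>The loss, conditional on signal \<open>s\<close>, relative to an affine bound \<open>x \<mapsto> \<alpha> + \<beta> * x\<close> on
  the payoff net of the cost potential, where \<open>x\<close> is the posterior.\<close>

definition gap ::
  "real \<Rightarrow> real \<Rightarrow> real \<Rightarrow> (state \<Rightarrow> 's pmf) \<Rightarrow> ('s \<Rightarrow> action pmf) \<Rightarrow> 's \<Rightarrow> real" where
  "gap \<alpha> \<beta> \<mu> \<phi> \<sigma> s =
     (let x = posterior \<mu> \<phi> s in
       pmf (\<sigma> s) Act_R * (\<alpha> + \<beta> * x - (x - lam * f x)) +
       pmf (\<sigma> s) Act_L * (\<alpha> + \<beta> * x - (1 - x - lam * f x)))"

text \<open>Posteriors average to the prior, so the affine bound has the same expectation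
  \<open>\<alpha> + \<beta> * \<mu>\<close> under every signal structure. Maximizing the objective
  thus means minimizing the expected gap.\<close>

lemma agent_objective_eq_gap:
  assumes \<mu>: "0 < \<mu>" "\<mu> < 1"
    and fin: "\<And>s. s \<in> set_pmf (signal_dist \<mu> \<phi>) \<Longrightarrow> chat (posterior \<mu> \<phi> s) \<noteq> \<infinity>"
    and int: "integrable (measure_pmf (signal_dist \<mu> \<phi>)) (\<lambda>s. f (posterior \<mu> \<phi> s))"
  shows "integrable (measure_pmf (signal_dist \<mu> \<phi>)) (gap \<alpha> \<beta> \<mu> \<phi> \<sigma>)"
    and "agent_objective chat lam \<mu> \<phi> \<sigma> = ereal (\<alpha> + \<beta> * \<mu> + lam * f \<mu> -
           measure_pmf.expectation (signal_dist \<mu> \<phi>) (gap \<alpha> \<beta> \<mu> \<phi> \<sigma>))"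
proof -
  let ?p = "measure_pmf (signal_dist \<mu> \<phi>)" and ?x = "posterior \<mu> \<phi>"
  define v where "v s = ?x s * pmf (\<sigma> s) Act_R + (1 - ?x s) * pmf (\<sigma> s) Act_L" for s
  have \<mu>': "\<mu> \<in> {0..1}" using \<mu> by simp
  have gap_eq: "gap \<alpha> \<beta> \<mu> \<phi> \<sigma> = (\<lambda>s. \<alpha> + \<beta> * ?x s + lam * f (?x s) - v s)"
    by (rule ext) (simp add: gap_def v_def Let_def pmf_Act_L algebra_simps)
  have x: "\<bar>?x s\<bar> \<le> 1" for s using posterior_in[OF \<mu>', of \<phi> s] by auto
  have "0 \<le> v s \<and> v s \<le> 1" for s
    using posterior_in[OF \<mu>', of \<phi> s] convex_bound_le[of "pmf (\<sigma> s) Act_R" 1 "pmf (\<sigma> s) Act_L" "?x s" "1 - ?x s"]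
    by (auto simp: v_def pmf_le_1 mult.commute)
  then have v: "\<bar>v s\<bar> \<le> 1" for s by simp
  have ints: "integrable ?p ?x" "integrable ?p v" "integrable ?p (\<lambda>s. f (?x s))"
    using integrable_pmf_bounded[of ?x, OF x] integrable_pmf_bounded[of v, OF v] int by blast+
  show "integrable ?p (gap \<alpha> \<beta> \<mu> \<phi> \<sigma>)"
    unfolding gap_eq using ints by (intro Bochner_Integration.integrable_diff Bochner_Integration.integrable_add) auto
  have mean: "(\<integral>s. ?x s \<partial>?p) = \<mu>"
    using expectation_posterior(1)[OF \<mu>', of \<phi> "\<lambda>_. 1"] by simp
  have gap_int: "(\<integral>s. gap \<alpha> \<beta> \<mu> \<phi> \<sigma> s \<partial>?p) = \<alpha> + \<beta> * \<mu> + lam * (\<integral>s. f (?x s) \<partial>?p) - (\<integral>s. v s \<partial>?p)"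
    unfolding gap_eq using ints
    by (simp add: mean Bochner_Integration.integral_add Bochner_Integration.integral_diff)
  have "ereal_expectation (signal_dist \<mu> \<phi>) (\<lambda>s. chat (?x s)) = ereal (\<integral>s. f (?x s) \<partial>?p)"
    by (rule ereal_expectation_integrable[OF int]) (rule chat_eq_if_finite[OF posterior_in[OF \<mu>'] fin])
  then show "agent_objective chat lam \<mu> \<phi> \<sigma> = ereal (\<alpha> + \<beta> * \<mu> + lam * f \<mu> - (\<integral>s. gap \<alpha> \<beta> \<mu> \<phi> \<sigma> s \<partial>?p))"
    unfolding agent_objective_def expected_payoff_posterior[OF \<mu>'] info_cost_def chat_eq[OF \<mu>]
      gap_int v_def[symmetric]
    by (simp add: right_diff_distrib)
qed

lemma agent_objective_finiteD:
  assumes \<mu>: "0 < \<mu>" "\<mu> < 1" and obj: "agent_objective chat lam \<mu> \<phi> \<sigma> \<noteq> - \<infinity>"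
  shows "s \<in> set_pmf (signal_dist \<mu> \<phi>) \<Longrightarrow> chat (posterior \<mu> \<phi> s) \<noteq> \<infinity>"
    and "integrable (measure_pmf (signal_dist \<mu> \<phi>)) (\<lambda>s. f (posterior \<mu> \<phi> s))"
proof -
  have \<mu>': "\<mu> \<in> {0..1}" using \<mu> by simp
  have fin: "ereal_expectation (signal_dist \<mu> \<phi>) (\<lambda>s. chat (posterior \<mu> \<phi> s)) \<noteq> \<infinity>"
    using obj lam_pos unfolding agent_objective_def info_cost_def chat_eq[OF \<mu>] by auto
  show "s \<in> set_pmf (signal_dist \<mu> \<phi>) \<Longrightarrow> chat (posterior \<mu> \<phi> s) \<noteq> \<infinity>"
    and "integrable (measure_pmf (signal_dist \<mu> \<phi>)) (\<lambda>s. f (posterior \<mu> \<phi> s))"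
    using ereal_expectation_finiteD(1)[OF chat_ge[OF posterior_in[OF \<mu>']] fin]
      ereal_expectation_finiteD(2)[OF chat_ge[OF posterior_in[OF \<mu>']] fin]
    unfolding f_def by simp_all
qed

text \<open>Complementary slackness. The comparison strategy \<open>\<phi>\<^sub>0\<close>,
  \<open>\<sigma>\<^sub>0\<close> has zero gap and attains the bound, so the optimal one does too.
  Its nonnegative gap has expectation zero and vanishes on the support, and so does each of the two
  summands.\<close>

lemma optimal_strategy_tight:
  fixes \<phi> \<phi>\<^sub>0 :: "state \<Rightarrow> 's pmf"
  assumes \<mu>: "0 < \<mu>" "\<mu> < 1" and opt: "optimal_strategy chat lam \<mu> \<phi> \<sigma>"
    and bound: "\<forall>x\<in>{0..1}. chat x \<noteq> \<infinity> \<longrightarrow>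
      x - lam * f x \<le> \<alpha> + \<beta> * x \<and> 1 - x - lam * f x \<le> \<alpha> + \<beta> * x"
    and finite: "finite (set_pmf (signal_dist \<mu> \<phi>\<^sub>0))"
    and tight: "\<forall>s\<in>set_pmf (signal_dist \<mu> \<phi>\<^sub>0).
      chat (posterior \<mu> \<phi>\<^sub>0 s) \<noteq> \<infinity> \<and> gap \<alpha> \<beta> \<mu> \<phi>\<^sub>0 \<sigma>\<^sub>0 s = 0"
    and s: "s \<in> set_pmf (signal_dist \<mu> \<phi>)"
  defines "x \<equiv> posterior \<mu> \<phi> s"
  shows "chat x \<noteq> \<infinity>"
    and "pmf (\<sigma> s) Act_R \<noteq> 0 \<Longrightarrow> x - lam * f x = \<alpha> + \<beta> * x"
    and "pmf (\<sigma> s) Act_L \<noteq> 0 \<Longrightarrow> 1 - x - lam * f x = \<alpha> + \<beta> * x"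
proof -
  let ?p = "measure_pmf (signal_dist \<mu> \<phi>)"
  have \<mu>': "\<mu> \<in> {0..1}" using \<mu> by simp
  have "measure_pmf.expectation (signal_dist \<mu> \<phi>\<^sub>0) (gap \<alpha> \<beta> \<mu> \<phi>\<^sub>0 \<sigma>\<^sub>0) = 0"
    by (rule integral_eq_zero_AE) (simp add: AE_measure_pmf_iff tight)
  then have "agent_objective chat lam \<mu> \<phi>\<^sub>0 \<sigma>\<^sub>0 = ereal (\<alpha> + \<beta> * \<mu> + lam * f \<mu>)"
    using agent_objective_eq_gap(2)[OF \<mu>, where \<phi> = \<phi>\<^sub>0 and \<sigma> = \<sigma>\<^sub>0 and \<alpha> = \<alpha> and \<beta> = \<beta>] tight
    by (simp add: integrable_measure_pmf_finite[OF finite])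
  then have obj: "ereal (\<alpha> + \<beta> * \<mu> + lam * f \<mu>) \<le> agent_objective chat lam \<mu> \<phi> \<sigma>"
    using opt unfolding optimal_strategy_def by metis
  then have "agent_objective chat lam \<mu> \<phi> \<sigma> \<noteq> - \<infinity>" by auto
  note fin = agent_objective_finiteD[OF \<mu> this]
  have gap: "integrable ?p (gap \<alpha> \<beta> \<mu> \<phi> \<sigma>)"
    "agent_objective chat lam \<mu> \<phi> \<sigma> =
      ereal (\<alpha> + \<beta> * \<mu> + lam * f \<mu> - measure_pmf.expectation (signal_dist \<mu> \<phi>) (gap \<alpha> \<beta> \<mu> \<phi> \<sigma>))"
    by (rule agent_objective_eq_gap[OF \<mu> _ fin(2)], erule fin(1))+
  have nonneg: "0 \<le> pmf (\<sigma> t) Act_R * (\<alpha> + \<beta> * posterior \<mu> \<phi> t - (posterior \<mu> \<phi> t - lam * f (posterior \<mu> \<phi> t)))"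
    "0 \<le> pmf (\<sigma> t) Act_L * (\<alpha> + \<beta> * posterior \<mu> \<phi> t - (1 - posterior \<mu> \<phi> t - lam * f (posterior \<mu> \<phi> t)))"
    if "t \<in> set_pmf (signal_dist \<mu> \<phi>)" for t
    using bound[rule_format, OF posterior_in[OF \<mu>'] fin(1)[OF that]] by simp_all
  have gap_nonneg: "0 \<le> gap \<alpha> \<beta> \<mu> \<phi> \<sigma> t" if "t \<in> set_pmf (signal_dist \<mu> \<phi>)" for t
    using nonneg[OF that] by (simp add: gap_def Let_def)
  have "measure_pmf.expectation (signal_dist \<mu> \<phi>) (gap \<alpha> \<beta> \<mu> \<phi> \<sigma>) \<le> 0"
    using obj unfolding gap(2) by simp
  moreover have "0 \<le> measure_pmf.expectation (signal_dist \<mu> \<phi>) (gap \<alpha> \<beta> \<mu> \<phi> \<sigma>)"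
    by (rule integral_nonneg_AE) (simp add: AE_measure_pmf_iff gap_nonneg)
  ultimately have "AE t in ?p. gap \<alpha> \<beta> \<mu> \<phi> \<sigma> t = 0"
    using integral_nonneg_eq_0_iff_AE[OF gap(1)] by (simp add: AE_measure_pmf_iff gap_nonneg)
  then have "gap \<alpha> \<beta> \<mu> \<phi> \<sigma> s = 0" using s by (simp add: AE_measure_pmf_iff)
  then show "pmf (\<sigma> s) Act_R \<noteq> 0 \<Longrightarrow> x - lam * f x = \<alpha> + \<beta> * x"
    and "pmf (\<sigma> s) Act_L \<noteq> 0 \<Longrightarrow> 1 - x - lam * f x = \<alpha> + \<beta> * x"
    unfolding gap_def Let_def add_nonneg_eq_0_iff[OF nonneg[OF s]] x_def by simp_all
  show "chat x \<noteq> \<infinity>" using fin(1)[OF s] by (simp add: x_def)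
qed

end

section \<open>Affine bounds on the net payoff and their points of contact\<close>

locale delegation_cutoff = delegation +
  fixes q :: real
  assumes q: "1/2 < q" "q < 1" and f'_q: "lam * f' q = 1"
begin

lemma net_payoff_tangent_less:
  assumes "0 < t" "t < 1" "x \<in> {0..1}" "chat x \<noteq> \<infinity>" "x \<noteq> t"
  shows "x - lam * f x < t - lam * f t + (1 - lam * f' t) * (x - t)"
proof -
  have "lam * (f t + f' t * (x - t)) < lam * f x"
    using tangent_less[OF assms] lam_pos by simp
  then show ?thesis by (simp add: algebra_simps)
qed

text \<open>The tangent of \<open>x - lam * f x\<close> at \<open>q\<close> is horizontal because
  \<open>lam * f' q = 1\<close>.\<close>

lemma net_payoff_less:
  assumes "x \<in> {0..1}" "chat x \<noteq> \<infinity>" "x \<noteq> q"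
  shows "x - lam * f x < q - lam * f q"
proof -
  have "x - lam * f x < q - lam * f q + (1 - lam * f' q) * (x - q)"
    by (rule net_payoff_tangent_less[OF _ q(2) assms]) (use q(1) in linarith)
  then show ?thesis unfolding f'_q by simp
qed

lemma net_payoff_L_less:
  assumes "x \<in> {0..1}" "chat x \<noteq> \<infinity>" "x \<noteq> 1 - q"
  shows "1 - x - lam * f x < q - lam * f q"
proof -
  have "1 - x \<in> {0..1}" "chat (1 - x) \<noteq> \<infinity>" "1 - x \<noteq> q"
    using assms unfolding chat_sym[OF assms(1), symmetric] by auto
  from net_payoff_less[OF this] show ?thesis unfolding f_sym[OF assms(1)] .
qed

lemma net_payoff_le:
  assumes "x \<in> {0..1}" "chat x \<noteq> \<infinity>"
  shows "x - lam * f x \<le> q - lam * f q" and "1 - x - lam * f x \<le> q - lam * f q"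
proof -
  show "x - lam * f x \<le> q - lam * f q"
    using net_payoff_less[OF assms] by (cases "x = q") (simp, linarith)
  have "f (1 - q) = f q" using f_sym[of q] q by simp
  then show "1 - x - lam * f x \<le> q - lam * f q"
    using net_payoff_L_less[OF assms] by (cases "x = 1 - q") (simp, linarith)
qed

text \<open>The line is the tangent of \<open>x - lam * f x\<close> at \<open>\<mu>\<close>, falling
  because \<open>\<mu> > q\<close>. From \<open>q\<close> on, action L pays less than R. To the left
  of \<open>q\<close> its net payoff is at most \<open>q - lam * f q\<close>, which lies below the
  line at \<open>q\<close> and hence below the line at \<open>x\<close>.\<close>

lemma net_payoff_affine_bound_high:
  assumes \<mu>: "q < \<mu>" "\<mu> < 1"
  obtains \<alpha> \<beta> where "\<mu> - lam * f \<mu> = \<alpha> + \<beta> * \<mu>"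
    and "\<And>x. x \<in> {0..1} \<Longrightarrow> chat x \<noteq> \<infinity> \<Longrightarrow> x - lam * f x \<le> \<alpha> + \<beta> * x"
    and "\<And>x. x \<in> {0..1} \<Longrightarrow> chat x \<noteq> \<infinity> \<Longrightarrow> 1 - x - lam * f x < \<alpha> + \<beta> * x"
proof
  define \<beta> where "\<beta> = 1 - lam * f' \<mu>"
  define \<alpha> where "\<alpha> = \<mu> - lam * f \<mu> - \<beta> * \<mu>"
  have "lam * f' q < lam * f' \<mu>"
    using f'_strict_mono[of q \<mu>] \<mu> q lam_pos by simp
  then have \<beta>: "\<beta> < 0" by (simp add: \<beta>_def f'_q)
  show eq: "\<mu> - lam * f \<mu> = \<alpha> + \<beta> * \<mu>" by (simp add: \<alpha>_def)
  have less: "x - lam * f x < \<alpha> + \<beta> * x" if "x \<in> {0..1}" "chat x \<noteq> \<infinity>" "x \<noteq> \<mu>" for x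
    using net_payoff_tangent_less[of \<mu> x] that \<mu> q by (simp add: \<alpha>_def \<beta>_def algebra_simps)
  then show le: "x - lam * f x \<le> \<alpha> + \<beta> * x" if "x \<in> {0..1}" "chat x \<noteq> \<infinity>" for x
    using that eq by (cases "x = \<mu>") (auto intro: less_imp_le)
  show "1 - x - lam * f x < \<alpha> + \<beta> * x" if x: "x \<in> {0..1}" "chat x \<noteq> \<infinity>" for x
  proof (cases "x < q")
    case True
    have "1 - x - lam * f x \<le> q - lam * f q" by (rule net_payoff_le(2)[OF x])
    also have "\<dots> < \<alpha> + \<beta> * q" using less[of q] q \<mu> chat_eq[of q] by simp
    also have "\<dots> \<le> \<alpha> + \<beta> * x" using True \<beta> by (simp add: mult_left_mono_neg)
    finally show ?thesis .
  next
    case False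
    then show ?thesis using le[OF x] q by simp
  qed
qed

text \<open>The bound for the prior \<open>1 - \<mu>\<close>, reflected by
  \<open>x \<mapsto> 1 - x\<close>.\<close>

lemma net_payoff_affine_bound_low:
  assumes \<mu>: "0 < \<mu>" "\<mu> < 1 - q"
  obtains \<alpha> \<beta> where "1 - \<mu> - lam * f \<mu> = \<alpha> + \<beta> * \<mu>"
    and "\<And>x. x \<in> {0..1} \<Longrightarrow> chat x \<noteq> \<infinity> \<Longrightarrow> 1 - x - lam * f x \<le> \<alpha> + \<beta> * x"
    and "\<And>x. x \<in> {0..1} \<Longrightarrow> chat x \<noteq> \<infinity> \<Longrightarrow> x - lam * f x < \<alpha> + \<beta> * x"
proof -
  obtain \<alpha> \<beta> where *: "1 - \<mu> - lam * f (1 - \<mu>) = \<alpha> + \<beta> * (1 - \<mu>)"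
    "\<And>x. x \<in> {0..1} \<Longrightarrow> chat x \<noteq> \<infinity> \<Longrightarrow> x - lam * f x \<le> \<alpha> + \<beta> * x"
    "\<And>x. x \<in> {0..1} \<Longrightarrow> chat x \<noteq> \<infinity> \<Longrightarrow> 1 - x - lam * f x < \<alpha> + \<beta> * x"
    using net_payoff_affine_bound_high[of "1 - \<mu>"] \<mu> by auto
  show thesis
  proof (rule that[of "\<alpha> + \<beta>" "- \<beta>"])
    show "1 - \<mu> - lam * f \<mu> = \<alpha> + \<beta> + - \<beta> * \<mu>"
      using *(1) \<mu> q by (simp add: f_sym algebra_simps)
    fix x assume x: "x \<in> {0..1}" "chat x \<noteq> \<infinity>"
    then have x': "1 - x \<in> {0..1}" "chat (1 - x) \<noteq> \<infinity>"
      unfolding chat_sym[OF x(1), symmetric] by auto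
    show "1 - x - lam * f x \<le> \<alpha> + \<beta> + - \<beta> * x"
      using *(2)[OF x'] x by (simp add: f_sym algebra_simps)
    show "x - lam * f x < \<alpha> + \<beta> + - \<beta> * x"
      using *(3)[OF x'] x by (simp add: f_sym algebra_simps)
  qed
qed

section \<open>Optimal strategies in the three ranges of the prior\<close>

lemma no_information:
  assumes "0 < \<mu>" "\<mu> < 1"
  shows "set_pmf (signal_dist \<mu> (\<lambda>_. return_pmf s)) = {s}"
    and "posterior \<mu> (\<lambda>_. return_pmf s) s = \<mu>"
proof -
  have "signal_dist \<mu> (\<lambda>_. return_pmf s) = return_pmf s" by (simp add: signal_dist_def)
  then show "set_pmf (signal_dist \<mu> (\<lambda>_. return_pmf s)) = {s}"
    and "posterior \<mu> (\<lambda>_. return_pmf s) s = \<mu>"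
    by (simp_all add: posterior_def)
qed

text \<open>Always playing R on a constant signal touches the tangent bound at the prior. An optimal
  strategy is therefore tight as well, and the strict bound for L excludes L.\<close>

lemma optimal_strategy_high:
  fixes \<phi> :: "state \<Rightarrow> 's pmf"
  assumes \<mu>: "q < \<mu>" "\<mu> < 1" and opt: "optimal_strategy chat lam \<mu> \<phi> \<sigma>"
  shows "s \<in> set_pmf (signal_dist \<mu> \<phi>) \<Longrightarrow> pmf (\<sigma> s) Act_L = 0"
proof -
  obtain \<alpha> \<beta> where *: "\<mu> - lam * f \<mu> = \<alpha> + \<beta> * \<mu>"
    "\<And>x. x \<in> {0..1} \<Longrightarrow> chat x \<noteq> \<infinity> \<Longrightarrow> x - lam * f x \<le> \<alpha> + \<beta> * x"
    "\<And>x. x \<in> {0..1} \<Longrightarrow> chat x \<noteq> \<infinity> \<Longrightarrow> 1 - x - lam * f x < \<alpha> + \<beta> * x"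
    using net_payoff_affine_bound_high[OF \<mu>] by blast
  have \<mu>01: "0 < \<mu>" "\<mu> < 1" using \<mu> q by auto
  note tight = optimal_strategy_tight[OF \<mu>01 opt,
      where \<phi>\<^sub>0 = "\<lambda>_. return_pmf undefined" and \<sigma>\<^sub>0 = "\<lambda>_. return_pmf Act_R"
        and \<alpha> = \<alpha> and \<beta> = \<beta>]
  show "pmf (\<sigma> s) Act_L = 0" if s: "s \<in> set_pmf (signal_dist \<mu> \<phi>)"
  proof (rule ccontr)
    assume L: "pmf (\<sigma> s) Act_L \<noteq> 0"
    have "chat (posterior \<mu> \<phi> s) \<noteq> \<infinity>"
      and "1 - posterior \<mu> \<phi> s - lam * f (posterior \<mu> \<phi> s) = \<alpha> + \<beta> * posterior \<mu> \<phi> s"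
      using tight(1,3)[OF _ _ _ s] L *
      by (auto simp: no_information[OF \<mu>01] gap_def chat_eq[OF \<mu>01] less_imp_le)
    then show False using *(3)[OF posterior_in[of \<mu> \<phi> s]] \<mu>01 by auto
  qed
qed

lemma optimal_strategy_low:
  fixes \<phi> :: "state \<Rightarrow> 's pmf"
  assumes \<mu>: "0 < \<mu>" "\<mu> < 1 - q" and opt: "optimal_strategy chat lam \<mu> \<phi> \<sigma>"
  shows "s \<in> set_pmf (signal_dist \<mu> \<phi>) \<Longrightarrow> pmf (\<sigma> s) Act_R = 0"
proof -
  obtain \<alpha> \<beta> where *: "1 - \<mu> - lam * f \<mu> = \<alpha> + \<beta> * \<mu>"
    "\<And>x. x \<in> {0..1} \<Longrightarrow> chat x \<noteq> \<infinity> \<Longrightarrow> 1 - x - lam * f x \<le> \<alpha> + \<beta> * x"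
    "\<And>x. x \<in> {0..1} \<Longrightarrow> chat x \<noteq> \<infinity> \<Longrightarrow> x - lam * f x < \<alpha> + \<beta> * x"
    using net_payoff_affine_bound_low[OF \<mu>] by blast
  have \<mu>01: "0 < \<mu>" "\<mu> < 1" using \<mu> q by auto
  note tight = optimal_strategy_tight[OF \<mu>01 opt,
      where \<phi>\<^sub>0 = "\<lambda>_. return_pmf undefined" and \<sigma>\<^sub>0 = "\<lambda>_. return_pmf Act_L"
        and \<alpha> = \<alpha> and \<beta> = \<beta>]
  show "pmf (\<sigma> s) Act_R = 0" if s: "s \<in> set_pmf (signal_dist \<mu> \<phi>)"
  proof (rule ccontr)
    assume R: "pmf (\<sigma> s) Act_R \<noteq> 0"
    have "chat (posterior \<mu> \<phi> s) \<noteq> \<infinity>"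
      and "posterior \<mu> \<phi> s - lam * f (posterior \<mu> \<phi> s) = \<alpha> + \<beta> * posterior \<mu> \<phi> s"
      using tight(1,2)[OF _ _ _ s] R *
      by (auto simp: no_information[OF \<mu>01] gap_def chat_eq[OF \<mu>01] less_imp_le)
    then show False using *(3)[OF posterior_in[of \<mu> \<phi> s]] \<mu>01 by auto
  qed
qed

text \<open>The prior \<open>\<mu>\<close> is the mixture \<open>\<rho> * q + (1 - \<rho>) * (1 - q)\<close> of the two posteriors.\<close>

lemma two_point_signal:
  fixes a b :: 's
  assumes ab: "a \<noteq> b" and \<mu>: "1 - q \<le> \<mu>" "\<mu> \<le> q"
  obtains \<phi> where "set_pmf (signal_dist \<mu> \<phi>) \<subseteq> {a, b}"
    and "a \<in> set_pmf (signal_dist \<mu> \<phi>) \<Longrightarrow> posterior \<mu> \<phi> a = q"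
    and "b \<in> set_pmf (signal_dist \<mu> \<phi>) \<Longrightarrow> posterior \<mu> \<phi> b = 1 - q"
proof -
  define \<rho> where "\<rho> = (\<mu> - (1 - q)) / (2 * q - 1)"
  have \<rho>: "0 \<le> \<rho>" "\<rho> \<le> 1" using \<mu> q by (auto simp: \<rho>_def)
  have "\<rho> * (2 * q - 1) = \<mu> - (1 - q)" using q by (simp add: \<rho>_def)
  then have mix: "\<mu> = \<rho> * q + (1 - \<rho>) * (1 - q)" "1 - \<mu> = \<rho> * (1 - q) + (1 - \<rho>) * q"
    by (simp_all add: algebra_simps)
  have \<mu>01: "0 < \<mu>" "\<mu> < 1" and \<mu>': "\<mu> \<in> {0..1}" using \<mu> q by auto
  \<comment> \<open>Bayes' rule solved for the chance of signal \<open>a\<close> in each state, with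
    \<open>\<rho>\<close> its unconditional probability. At \<open>\<mu> = q\<close> or
    \<open>\<mu> = 1 - q\<close> one signal is null, hence the support conditions on the
    posteriors.\<close>
  define r where "r \<omega> = (case \<omega> of State_r \<Rightarrow> q * \<rho> / \<mu> | State_l \<Rightarrow> (1 - q) * \<rho> / (1 - \<mu>))" for \<omega>
  define \<phi> where "\<phi> \<omega> = bind_pmf (bernoulli_pmf (r \<omega>)) (\<lambda>c. return_pmf (if c then a else b))" for \<omega>
  have nonneg: "0 \<le> q * \<rho>" "0 \<le> (1 - q) * \<rho>" "0 \<le> (1 - \<rho>) * (1 - q)" "0 \<le> (1 - \<rho>) * q"
    using \<rho> q by auto
  have "q * \<rho> \<le> \<mu>" "(1 - q) * \<rho> \<le> 1 - \<mu>"
    unfolding mix(2) using nonneg mix(1) by (simp_all add: mult.commute)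
  then have r: "0 \<le> r \<omega>" "r \<omega> \<le> 1" for \<omega>
    using nonneg(1,2) \<mu>01 by (cases \<omega>; simp add: r_def)+
  have \<phi>: "pmf (\<phi> \<omega>) a = r \<omega>" "pmf (\<phi> \<omega>) b = 1 - r \<omega>" for \<omega>
    using ab r[of \<omega>] by (auto simp: \<phi>_def pmf_bind)
  have *: "\<mu> * r State_r = q * \<rho>" "(1 - \<mu>) * r State_l = (1 - q) * \<rho>"
    using \<mu>01 by (auto simp: r_def)
  have "\<mu> * (1 - r State_r) = \<mu> - q * \<rho>" "(1 - \<mu>) * (1 - r State_l) = (1 - \<mu>) - (1 - q) * \<rho>"
    by (simp_all add: right_diff_distrib * del: left_diff_distrib')
  moreover have "\<mu> - q * \<rho> = (1 - q) * (1 - \<rho>)" "(1 - \<mu>) - (1 - q) * \<rho> = q * (1 - \<rho>)"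
    using mix(1) by (simp_all add: algebra_simps)
  ultimately have **: "\<mu> * (1 - r State_r) = (1 - q) * (1 - \<rho>)"
    "(1 - \<mu>) * (1 - r State_l) = q * (1 - \<rho>)"
    by simp_all
  have p: "pmf (signal_dist \<mu> \<phi>) a = \<rho>" "pmf (signal_dist \<mu> \<phi>) b = 1 - \<rho>"
    unfolding pmf_signal_dist[OF \<mu>'] \<phi> * ** by (simp_all add: algebra_simps)
  have w: "\<mu> * pmf (\<phi> State_r) a = q * \<rho>" "\<mu> * pmf (\<phi> State_r) b = (1 - q) * (1 - \<rho>)"
    unfolding \<phi> by (fact *(1), fact **(1))
  show thesis
  proof
    show "set_pmf (signal_dist \<mu> \<phi>) \<subseteq> {a, b}"
      by (auto simp: signal_dist_def \<phi>_def split: if_splits)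
    show "posterior \<mu> \<phi> a = q" if "a \<in> set_pmf (signal_dist \<mu> \<phi>)"
      using that p(1) w(1) by (simp add: posterior_def set_pmf_iff)
    show "posterior \<mu> \<phi> b = 1 - q" if "b \<in> set_pmf (signal_dist \<mu> \<phi>)"
      using that p(2) w(2) by (simp add: posterior_def set_pmf_iff)
  qed
qed

text \<open>The bound is the horizontal line of height \<open>q - lam * f q\<close>. The two-point
  signal attains it, and the net payoffs of R and L touch it only at \<open>q\<close> and
  \<open>1 - q\<close> respectively.\<close>

lemma optimal_strategy_middle:
  fixes \<phi> :: "state \<Rightarrow> 's pmf"
  assumes rich: "\<exists>s s' :: 's. s \<noteq> s'"
    and \<mu>: "1 - q \<le> \<mu>" "\<mu> \<le> q" and opt: "optimal_strategy chat lam \<mu> \<phi> \<sigma>"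
    and s: "s \<in> set_pmf (signal_dist \<mu> \<phi>)"
  shows "pmf (\<sigma> s) Act_R \<noteq> 0 \<Longrightarrow> posterior \<mu> \<phi> s = q"
    and "pmf (\<sigma> s) Act_L \<noteq> 0 \<Longrightarrow> posterior \<mu> \<phi> s = 1 - q"
proof -
  obtain a b :: 's where ab: "a \<noteq> b" using rich by blast
  obtain \<phi>\<^sub>0 where \<phi>\<^sub>0: "set_pmf (signal_dist \<mu> \<phi>\<^sub>0) \<subseteq> {a, b}"
    "a \<in> set_pmf (signal_dist \<mu> \<phi>\<^sub>0) \<Longrightarrow> posterior \<mu> \<phi>\<^sub>0 a = q"
    "b \<in> set_pmf (signal_dist \<mu> \<phi>\<^sub>0) \<Longrightarrow> posterior \<mu> \<phi>\<^sub>0 b = 1 - q"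
    using two_point_signal[OF ab \<mu>] by blast
  define \<sigma>\<^sub>0 where "\<sigma>\<^sub>0 s = return_pmf (if s = a then Act_R else Act_L)" for s
  have \<mu>01: "0 < \<mu>" "\<mu> < 1" using \<mu> q by auto
  have \<mu>': "\<mu> \<in> {0..1}" using \<mu>01 by simp
  have finite: "finite (set_pmf (signal_dist \<mu> \<phi>\<^sub>0))"
    using \<phi>\<^sub>0(1) by (rule finite_subset) simp
  have fin: "chat q \<noteq> \<infinity>" "chat (1 - q) \<noteq> \<infinity>" using chat_eq[of q] chat_eq[of "1 - q"] q by auto
  have tight: "\<forall>s\<in>set_pmf (signal_dist \<mu> \<phi>\<^sub>0).
      chat (posterior \<mu> \<phi>\<^sub>0 s) \<noteq> \<infinity> \<and> gap (q - lam * f q) 0 \<mu> \<phi>\<^sub>0 \<sigma>\<^sub>0 s = 0"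
    using \<phi>\<^sub>0 fin ab q by (auto simp: gap_def \<sigma>\<^sub>0_def f_sym)
  have bound: "\<forall>x\<in>{0..1}. chat x \<noteq> \<infinity> \<longrightarrow>
      x - lam * f x \<le> q - lam * f q + 0 * x \<and> 1 - x - lam * f x \<le> q - lam * f q + 0 * x"
    using net_payoff_le by simp
  note t = optimal_strategy_tight[OF \<mu>01 opt bound finite tight s]
  show "posterior \<mu> \<phi> s = q" if "pmf (\<sigma> s) Act_R \<noteq> 0"
    using net_payoff_less[OF posterior_in[OF \<mu>'] t(1)] t(2)[OF that] by linarith
  show "posterior \<mu> \<phi> s = 1 - q" if "pmf (\<sigma> s) Act_L \<noteq> 0"
    using net_payoff_L_less[OF posterior_in[OF \<mu>'] t(1)] t(3)[OF that] by linarith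
qed

lemma principal_value_eq:
  fixes \<phi> :: "real \<Rightarrow> state \<Rightarrow> 's pmf"
  assumes rich: "\<exists>s s' :: 's. s \<noteq> s'" and \<mu>: "\<mu> \<in> {0<..<1}"
    and opt: "optimal_strategy chat lam \<mu> (\<phi> \<mu>) (\<sigma> \<mu>)"
  shows "principal_value \<phi> \<sigma> p \<mu> = delegation_value q p \<mu>"
proof -
  define P where "P = signal_dist \<mu> (\<phi> \<mu>)"
  define x where "x = posterior \<mu> (\<phi> \<mu>)"
  define R where "R s = pmf (\<sigma> \<mu> s) Act_R" for s
  define \<pi>\<^sub>R where "\<pi>\<^sub>R = choice_prob (\<phi> \<mu>) (\<sigma> \<mu>) Act_R State_r"
  define \<pi>\<^sub>L where "\<pi>\<^sub>L = choice_prob (\<phi> \<mu>) (\<sigma> \<mu>) Act_L State_l"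
  have \<mu>01: "0 < \<mu>" "\<mu> < 1" and \<mu>': "\<mu> \<in> {0..1}" using \<mu> by auto
  have prob_R: "\<mu> * \<pi>\<^sub>R = measure_pmf.expectation P (\<lambda>s. x s * R s)"
    and prob_L: "(1 - \<mu>) * \<pi>\<^sub>L = measure_pmf.expectation P (\<lambda>s. (1 - x s) * (1 - R s))"
    using choice_prob_posterior(1)[OF \<mu>', of "\<phi> \<mu>" "\<sigma> \<mu>" Act_R]
      choice_prob_posterior(2)[OF \<mu>', of "\<phi> \<mu>" "\<sigma> \<mu>" Act_L]
    by (simp_all add: \<pi>\<^sub>R_def \<pi>\<^sub>L_def P_def x_def R_def pmf_Act_L)
  have mean: "measure_pmf.expectation P x = \<mu>"
    using expectation_posterior(1)[OF \<mu>', of "\<phi> \<mu>" "\<lambda>_. 1"] by (simp add: P_def x_def)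
  have cong: "measure_pmf.expectation P g = measure_pmf.expectation P h"
    if "\<And>s. s \<in> set_pmf P \<Longrightarrow> g s = h s" for g h :: "'s \<Rightarrow> real"
    using that by (intro integral_cong_AE) (auto simp: AE_measure_pmf_iff)
  have int_R: "integrable (measure_pmf P) R"
    by (rule integrable_pmf_bounded[where B = 1]) (simp add: R_def pmf_le_1)
  have pv: "principal_value \<phi> \<sigma> p \<mu> = p * \<pi>\<^sub>R + (1 - p) * \<pi>\<^sub>L"
    by (simp add: principal_value_def \<pi>\<^sub>R_def \<pi>\<^sub>L_def)
  consider "\<mu> < 1 - q" | "q < \<mu>" | "1 - q \<le> \<mu>" "\<mu> \<le> q" by linarith
  then show ?thesis
  proof cases
    case 1
    have R: "R s = 0" if "s \<in> set_pmf P" for s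
      using optimal_strategy_low[OF \<mu>01(1) 1 opt] that by (simp add: P_def R_def)
    have "\<mu> * \<pi>\<^sub>R = 0"
      unfolding prob_R by (subst cong[of _ "\<lambda>_. 0"]) (auto simp: R)
    moreover have "(1 - \<mu>) * \<pi>\<^sub>L = 1 - \<mu>"
      unfolding prob_L using mean expectation_posterior(2)[OF \<mu>', of "\<phi> \<mu>" "\<lambda>_. 1"]
      by (subst cong[of _ "\<lambda>s. 1 - x s"]) (auto simp: R P_def x_def)
    ultimately show ?thesis using 1 \<mu>01 by (simp add: pv delegation_value_def)
  next
    case 2
    have R: "R s = 1" if "s \<in> set_pmf P" for s
      using optimal_strategy_high[OF 2 \<mu>01(2) opt that[unfolded P_def]]
      unfolding R_def pmf_Act_L by linarith
    have "(1 - \<mu>) * \<pi>\<^sub>L = 0"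
      unfolding prob_L by (subst cong[of _ "\<lambda>_. 0"]) (auto simp: R)
    moreover have "\<mu> * \<pi>\<^sub>R = \<mu>"
      unfolding prob_R using mean by (subst cong[of _ x]) (auto simp: R)
    ultimately show ?thesis using 2 \<mu>01 q by (simp add: pv delegation_value_def)
  next
    case 3
    define \<rho> where "\<rho> = measure_pmf.expectation P R"
    have R: "x s * R s = q * R s" "(1 - x s) * (1 - R s) = q * (1 - R s)"
      if "s \<in> set_pmf P" for s
    proof -
      \<comment> \<open>Written as products, the contact conditions also cover signals after which
        the action might be random.\<close>
      have "R s = 0 \<or> x s = q" "1 - R s = 0 \<or> 1 - x s = q"
        using optimal_strategy_middle[OF rich 3 opt that[unfolded P_def]]
        unfolding R_def x_def pmf_Act_L by linarith+
      then show "x s * R s = q * R s" "(1 - x s) * (1 - R s) = q * (1 - R s)"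
        by (metis mult_zero_right)+
    qed
    have x: "x s = q * R s + (1 - q) * (1 - R s)" if "s \<in> set_pmf P" for s
    proof -
      have "x s = x s * R s + (1 - R s) - (1 - x s) * (1 - R s)" by (simp add: algebra_simps)
      also have "\<dots> = q * R s + (1 - q) * (1 - R s)" unfolding R[OF that] by (simp add: algebra_simps)
      finally show ?thesis .
    qed
    \<comment> \<open>Averaging the posteriors to the prior determines the total probability
      \<open>\<rho>\<close> of action R, and with it both choice probabilities.\<close>
    have "\<mu> = q * \<rho> + (1 - q) * (1 - \<rho>)"
      unfolding mean[symmetric] \<rho>_def using int_R
      by (subst cong[OF x]) (simp_all add: Bochner_Integration.integral_add Bochner_Integration.integral_diff)
    then have "\<rho> * (2 * q - 1) = \<mu> - (1 - q)" "(1 - \<rho>) * (2 * q - 1) = q - \<mu>"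
      by (simp_all add: algebra_simps)
    then have \<rho>: "\<rho> = (\<mu> - (1 - q)) / (2 * q - 1)" "1 - \<rho> = (q - \<mu>) / (2 * q - 1)"
      using q by (simp_all add: eq_divide_eq)
    have "\<mu> * \<pi>\<^sub>R = q * \<rho>"
      unfolding prob_R \<rho>_def by (subst cong[OF R(1)]) simp_all
    moreover have "(1 - \<mu>) * \<pi>\<^sub>L = q * (1 - \<rho>)"
      unfolding prob_L \<rho>_def using int_R
      by (subst cong[OF R(2)]) (simp_all add: Bochner_Integration.integral_diff)
    ultimately have \<pi>: "\<pi>\<^sub>R = q * \<rho> / \<mu>" "\<pi>\<^sub>L = q * (1 - \<rho>) / (1 - \<mu>)"
      using \<mu>01 by (simp_all add: eq_divide_eq mult.commute)
    have "\<pi>\<^sub>R = q / (2 * q - 1) * ((\<mu> - (1 - q)) / \<mu>)"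
      unfolding \<pi>(1) \<rho>(1) by simp
    moreover have "\<pi>\<^sub>L = q / (2 * q - 1) * ((q - \<mu>) / (1 - \<mu>))"
      unfolding \<pi>(2) \<rho>(2) by simp
    moreover have "(\<mu> - (1 - q)) / \<mu> = 1 - (1 - q) / \<mu>" "(q - \<mu>) / (1 - \<mu>) = 1 - (1 - q) / (1 - \<mu>)"
      using \<mu>01 by (simp_all add: field_simps)
    ultimately have "\<pi>\<^sub>R = q / (2 * q - 1) * (1 - (1 - q) / \<mu>)"
      "\<pi>\<^sub>L = q / (2 * q - 1) * (1 - (1 - q) / (1 - \<mu>))"
      by simp_all
    then have "principal_value \<phi> \<sigma> p \<mu> = q / (2 * q - 1) *
        (p * (1 - (1 - q) / \<mu>) + (1 - p) * (1 - (1 - q) / (1 - \<mu>)))"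
      unfolding pv by (simp only: distrib_left mult.left_commute)
    also have "p * (1 - (1 - q) / \<mu>) + (1 - p) * (1 - (1 - q) / (1 - \<mu>)) =
        1 - (1 - q) * (p / \<mu> + (1 - p) / (1 - \<mu>))"
      by (simp add: algebra_simps add_divide_distrib diff_divide_distrib)
    finally show ?thesis using 3 by (simp add: delegation_value_def)
  qed
qed

end

theorem corollary1:
  fixes chat :: "real \<Rightarrow> ereal" and lam :: real
    and \<phi> :: "real \<Rightarrow> state \<Rightarrow> 's pmf" and \<sigma> :: "real \<Rightarrow> 's \<Rightarrow> action pmf"
  assumes "cost_potential chat" and "lam > 0"
    and rich: "\<exists>s s' :: 's. s \<noteq> s'"
    and opt: "\<forall>\<mu>\<in>{0<..<1}. optimal_strategy chat lam \<mu> (\<phi> \<mu>) (\<sigma> \<mu>)"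
  shows "(\<forall>\<mu>p\<in>{1/2<..<1}. best_prior \<mu>p \<in> {0<..<1} \<and>
            (\<forall>\<mu>\<in>{0<..<1}. principal_value \<phi> \<sigma> \<mu>p \<mu> \<le> principal_value \<phi> \<sigma> \<mu>p (best_prior \<mu>p)))
       \<and> single_peaked_on {1/2<..<1} (\<lambda>\<mu>p. \<bar>\<mu>p - best_prior \<mu>p\<bar>)
       \<and> single_peaked_on {1/2<..<1}
           (\<lambda>\<mu>p. principal_value \<phi> \<sigma> \<mu>p (best_prior \<mu>p) - principal_value \<phi> \<sigma> \<mu>p \<mu>p)"
proof -
  interpret delegation chat lam
    by unfold_locales (use assms in auto)
  obtain q where q: "1/2 < q" "q < 1" "f' q = 1 / lam"
    using f'_attains[of "1 / lam"] lam_pos by auto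
  interpret delegation_cutoff chat lam q
    by unfold_locales (use q lam_pos in auto)
  have eq: "principal_value \<phi> \<sigma> p \<mu> = delegation_value q p \<mu>" if "\<mu> \<in> {0<..<1}" for p \<mu>
    using principal_value_eq[OF rich that] opt that by blast
  have best: "best_prior p \<in> {0<..<1}" if "p \<in> {1/2<..<1}" for p
    using best_prior_in[of p] that by auto
  \<comment> \<open>The two benefit functions are known to agree only for priors in the open unit
    interval, so the rewriting is done pointwise under the unfolded definition.\<close>
  have "single_peaked_on {1/2<..<1}
      (\<lambda>p. principal_value \<phi> \<sigma> p (best_prior p) - principal_value \<phi> \<sigma> p p)"
    using single_peaked_delegation_benefit[OF q(1,2)] best
    unfolding single_peaked_on_def monotone_on_def by (auto simp: eq)
  then show ?thesis
    using delegation_value_le_best_prior[OF q(1,2)] best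
    by (auto simp: eq single_peaked_misalignment)
qed

end
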